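(* Let $k_0\in\mathbb{N}$, let $k_1,k_2$ be integers with $1\le k_1,k_2\le k_0$, and let $U\in(0,\pi/2)$. For $L\in\mathbb{N}$ sufficiently large, consider on $[\pi L,\pi L+U]$ the functions $$f_1(t)=\sin^2t,\quad f_2(t)=\cos^2t,\quad f_3(t)=(t-\pi L)^{1/3},\quad f_4(t)=(t-\pi L)^{1/5},$$ and let $(\alpha_0^{i,k},\dots,\alpha_k^{i,k})$ be points generated by $f_i$ at $(U,L,k)$ (for $i=1$, $k=k_1$; for $i=2$, $k=k_2$; for $i=3,4$, $k\in\{k_1,k_2\}$). Then, as $L\to\infty$, $$ \left(\frac{\alpha_0^{3,k_2}-\pi L}{\alpha_0^{4,k_2}-\pi L}\right)^{1/2}\left\{\prod_{r=1}^{k_2}\frac{|\zeta(\frac12+i\alpha_r^{2,k_2})|^2\,|\zeta(\frac12+i\alpha_r^{3,k_2})|^3}{|\zeta(\frac12+i\alpha_r^{4,k_2})|^5}\right\}\cos^2(\alpha_0^{2,k_2}) $$ $$ +\left(\frac{\alpha_0^{3,k_1}-\pi L}{\alpha_0^{4,k_1}-\pi L}\right)^{1/2}\left\{\prod_{r=1}^{k_1}\frac{|\zeta(\frac12+i\alpha_r^{1,k_1})|^2\,|\zeta(\frac12+i\alpha_r^{3,k_1})|^3}{|\zeta(\frac12+i\alpha_r^{4,k_1})|^5}\right\}\sin^2(\alpha_0^{1,k_1})\ \sim\ \frac{81}{250}\sqrt{10}. $$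
   Context: Jacob's ladder. Let $\mu\in C^\infty([y_0,\infty))$ be a fixed increasing function, unbounded above, with $\mu(y)\ge 7y\ln y$. For all sufficiently large $T$ let $x=\varphi(T)$ be the solution of $$\int_0^{\mu(x)}\left|\zeta\left(\tfrac12+it\right)\right|^2e^{-2t/x}\,dt=\int_0^T\left|\zeta\left(\tfrac12+it\right)\right|^2dt .$$ The Jacob's ladder is $\varphi_1(T)=\tfrac12\varphi(T)$; it is a continuously differentiable, strictly increasing function for $T\ge T_0$ ($T_0$ large), with $\varphi_1(T)<T$ and $\varphi_1(T)\to\infty$ as $T\to\infty$. Put $$\tilde Z^2(t)=\frac{d\varphi_1(t)}{dt}=\frac{|\zeta(\frac12+it)|^2}{\omega(t)},\qquad \omega(t)=\left\{1+O\left(\frac{\ln\ln t}{\ln t}\right)\right\}\ln t .$$ Thus $\tilde Z^2\ge 0$. Reverse iterations. For large $L\in\mathbb{N}$ and $U\in(0,\pi/2)$ set $a_0=\pi L$, $b_0=\pi L+U$, and define $a_r,b_r$ ($r\ge1$) by $\varphi_1(a_r)=a_{r-1}$, $\varphi_1(b_r)=b_{r-1}$. The segment $[a_r,b_r]$ is the $r$-th reverse iteration of $[\pi L,\pi L+U]$. Generated points. Let $f\ge0$ be a continuous function, not identically zero, on $[\pi L,\pi L+U]$, and let $k\ge1$. Points $(\alpha_0,\dots,\alpha_k)$ are said to be generated by $f$ at $(U,L,k)$ if $\alpha_k\in(a_k,b_k)$, $\alpha_{r-1}=\varphi_1(\alpha_r)$ for $r=1,\dots,k$ (so $\alpha_0\in(\pi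 L,\pi L+U)$ and $\alpha_r\in(a_r,b_r)$), and $$\int_{\pi L}^{\pi L+U}f(t)\,dt=f(\alpha_0)\left(\prod_{r=1}^k\tilde Z^2(\alpha_r)\right)(b_k-a_k).$$ (This is the mean value theorem applied to the integral after the substitution by the $k$-th iterate of $\varphi_1$.) *)

theory Defs
  imports "HOL-Complex_Analysis.Complex_Analysis" "HOL-Library.Landau_Symbols"
begin

(* The analytic continuation of the Dirichlet series; it is unique on -{1} by the identity
   theorem, and the value at the pole 1 is irrelevant. *)
definition zeta :: "complex \<Rightarrow> complex" where
  "zeta = (SOME f. f holomorphic_on (- {1}) \<and>
             (\<forall>s. Re s > 1 \<longrightarrow> (\<lambda>n. of_nat (Suc n) powr (- s)) sums f s))"

definition zeta_crit :: "real \<Rightarrow> complex" where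
  "zeta_crit t = zeta (1/2 + \<i> * complex_of_real t)"

(* One-sided derivatives are taken at the endpoint a. *)
definition smooth_from :: "real \<Rightarrow> (real \<Rightarrow> real) \<Rightarrow> bool" where
  "smooth_from a g \<longleftrightarrow>
     (\<exists>D :: nat \<Rightarrow> real \<Rightarrow> real. (\<forall>y\<ge>a. D 0 y = g y) \<and>
        (\<forall>n. \<forall>y\<ge>a. (D n has_real_derivative D (Suc n) y) (at y within {a..})))"

definition admissible_mu :: "real \<Rightarrow> (real \<Rightarrow> real) \<Rightarrow> bool" where
  "admissible_mu y0 \<mu> \<longleftrightarrow>
     y0 > 0 \<and> smooth_from y0 \<mu> \<and> mono_on {y0..} \<mu> \<and> \<not> bdd_above (\<mu> ` {y0..}) \<and>
     (\<forall>y\<ge>y0. \<mu> y \<ge> 7 * y * ln y)"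

definition solves_ladder_eq :: "(real \<Rightarrow> real) \<Rightarrow> real \<Rightarrow> real \<Rightarrow> bool" where
  "solves_ladder_eq \<mu> T x \<longleftrightarrow>
     integral {0..\<mu> x} (\<lambda>t. (cmod (zeta_crit t))\<^sup>2 * exp (- 2 * t / x)) =
     integral {0..T} (\<lambda>t. (cmod (zeta_crit t))\<^sup>2)"

definition Z_tilde_sq :: "(real \<Rightarrow> real) \<Rightarrow> real \<Rightarrow> real" where
  "Z_tilde_sq \<phi>1 t = deriv \<phi>1 t"

(* phi1 is the Jacob's ladder attached to mu on [T0, oo), together with its standing
   properties. These do not all follow from the defining integral equation for a general
   smooth mu: differentiating that equation brings in the derivative of mu, on which no
   bound is imposed. *)
definition jacobs_ladder ::
  "real \<Rightarrow> (real \<Rightarrow> real) \<Rightarrow> real \<Rightarrow> (real \<Rightarrow> real) \<Rightarrow> (real \<Rightarrow> real) \<Rightarrow> bool" where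
  "jacobs_ladder y0 \<mu> T0 \<omega> \<phi>1 \<longleftrightarrow>
     (\<exists>\<phi>. \<forall>T\<ge>T0. \<phi> T \<ge> y0 \<and> solves_ladder_eq \<mu> T (\<phi> T) \<and> \<phi>1 T = \<phi> T / 2) \<and>
     continuous_on {T0..} \<phi>1 \<and>
     (\<forall>t>T0. \<phi>1 differentiable (at t)) \<and> continuous_on {T0<..} (deriv \<phi>1) \<and>
     strict_mono_on {T0..} \<phi>1 \<and>
     (\<forall>t\<ge>T0. \<phi>1 t < t) \<and>
     filterlim \<phi>1 at_top at_top \<and>
     (\<forall>t>T0. Z_tilde_sq \<phi>1 t = (cmod (zeta_crit t))\<^sup>2 / \<omega> t) \<and>
     (\<lambda>t. \<omega> t / ln t - 1) \<in> O[at_top](\<lambda>t. ln (ln t) / ln t)"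

(* r-fold inverse image of x under phi1 restricted to [T0, oo), where phi1 is injective.
   It is meaningful for all sufficiently large x (depending on r). *)
primrec rev_iter :: "(real \<Rightarrow> real) \<Rightarrow> real \<Rightarrow> nat \<Rightarrow> real \<Rightarrow> real" where
  "rev_iter \<phi>1 T0 0 x = x"
| "rev_iter \<phi>1 T0 (Suc r) x = the_inv_into {T0..} \<phi>1 (rev_iter \<phi>1 T0 r x)"

definition generated_by ::
  "(real \<Rightarrow> real) \<Rightarrow> real \<Rightarrow> (real \<Rightarrow> real) \<Rightarrow> real \<Rightarrow> nat \<Rightarrow> nat \<Rightarrow> (nat \<Rightarrow> real) \<Rightarrow> bool" where
  "generated_by \<phi>1 T0 f U L k \<alpha> \<longleftrightarrow>
     (let a = rev_iter \<phi>1 T0 k (pi * real L);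
          b = rev_iter \<phi>1 T0 k (pi * real L + U);
          I = {pi * real L..pi * real L + U}
      in k \<ge> 1 \<and> continuous_on I f \<and> (\<forall>t\<in>I. f t \<ge> 0) \<and> (\<exists>t\<in>I. f t \<noteq> 0) \<and>
         \<alpha> k \<in> {a<..<b} \<and>
         (\<forall>r\<in>{1..k}. \<alpha> (r - 1) = \<phi>1 (\<alpha> r)) \<and>
         integral I f = f (\<alpha> 0) * (\<Prod>r=1..k. Z_tilde_sq \<phi>1 (\<alpha> r)) * (b - a))"

(* The bases of the fractional powers are nonnegative on [pi L, pi L + U], where powr is
   the usual power (with 0 powr c = 0). The value for indices other than 1,...,4 is unused. *)
definition f_gen :: "nat \<Rightarrow> nat \<Rightarrow> real \<Rightarrow> real" where
  "f_gen i L t =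
     (if i = 1 then (sin t)\<^sup>2
      else if i = 2 then (cos t)\<^sup>2
      else if i = 3 then (t - pi * real L) powr (1/3)
      else (t - pi * real L) powr (1/5))"

end

(*
  Write J_i for the integral of f_i over [pi L, pi L + U], p_i for the product of the
  |zeta(1/2 + i alpha_r)| and W_i for the product of the omega(alpha_r). Generation by f_i
  says f_i(alpha_0) p_i^2 = J_i W_i / (b_k - a_k). Raising the relations for f_3 and f_4 to
  the powers 3/2 and 5/2 and combining them with the one for f_1 (or f_2), the lengths
  b_k - a_k cancel, and each summand equals
  J_i J_3^(3/2) / J_4^(5/2) * W_i W_3^(3/2) / W_4^(5/2), where J_1 + J_2 = U.

  The quotient of the W's tends to 1 because omega(t) ~ ln t and ln phi1(t) ~ ln t, so that
  ln alpha_r ~ ln(pi L) for every r. The lower bound for phi1 comes from integrating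
  phi1' = |zeta|^2 / omega over [T, 2T]; for this the crude bound
  int_T^2T |zeta(1/2 + it)|^2 dt >= T/16 suffices. It is
  read off from the expansion of (s - 1) zeta(s) into partial sums plus Taylor remainders of
  x^(1-s), integrated term by term; the same expansion, carried to higher order, also shows
  that the continuation of the Dirichlet series exists.
*)
theory Submission
  imports Defs "HOL-Real_Asymp.Real_Asymp"
begin

section \<open>Analytic continuation of the zeta function\<close>

definition dirichlet_zeta :: "complex \<Rightarrow> complex" where
  "dirichlet_zeta s = (\<Sum>n. of_nat (Suc n) powr (- s))"

text \<open>Remainder of the Taylor expansion of \<open>x powr (1 - s)\<close> at \<open>x = n + 1\<close>, taken at \<open>x = n + 2\<close>.\<close>

definition zeta_rem :: "nat \<Rightarrow> nat \<Rightarrow> complex \<Rightarrow> complex" where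
  "zeta_rem m n s = of_nat (Suc (Suc n)) powr (1 - s)
     - (\<Sum>j\<le>m. ((1 - s) gchoose j) * of_nat (Suc n) powr (1 - s - of_nat j))"

lemma norm_of_nat_Suc_powr: "norm (of_nat (Suc n) powr (s::complex)) = real (Suc n) powr Re s"
  using norm_powr_real_powr[of "of_nat (Suc n)" s] by (simp del: of_nat_Suc)

text \<open>Taylor's theorem for \<open>z powr (1 - s)\<close> on the unit segment from
  \<open>n + 1\<close> to \<open>n + 2\<close>. The exponent \<open>- Re s - real m\<close> is
  nonpositive by assumption, so the top derivative is largest at the left end. The factor
  \<open>Suc m\<close> is the quotient of \<open>fact (Suc m)\<close> by
  \<open>fact m\<close>.\<close>

lemma norm_zeta_rem_le:
  assumes "- real m \<le> Re s"
  shows "norm (zeta_rem m n s) \<le>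
    real (Suc m) * norm ((1 - s) gchoose Suc m) * real (Suc n) powr (- Re s - real m)"
proof -
  define f where "f = (\<lambda>j z. fact j * ((1 - s) gchoose j) * z powr (1 - s - of_nat j))"
  define S where "S = closed_segment (of_nat (Suc n)) (of_nat (Suc (Suc n)) :: complex)"
  define B where "B = fact (Suc m) * norm ((1 - s) gchoose Suc m) * real (Suc n) powr (- Re s - real m)"
  have S: "\<exists>x\<ge>real (Suc n). z = of_real x" if "z \<in> S" for z
  proof -
    from that obtain u where u: "0 \<le> u" "z = (1 - u) *\<^sub>R of_nat (Suc n) + u *\<^sub>R of_nat (Suc (Suc n))"
      by (auto simp: S_def closed_segment_def)
    hence "z = of_real (real (Suc n) + u)"
      by (simp add: scaleR_conv_of_real algebra_simps)
    with u show ?thesis by (intro exI[of _ "real (Suc n) + u"]) auto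
  qed
  have "norm (f 0 (of_nat (Suc (Suc n))) -
      (\<Sum>i\<le>m. f i (of_nat (Suc n)) * (of_nat (Suc (Suc n)) - of_nat (Suc n)) ^ i / fact i))
      \<le> B * norm (of_nat (Suc (Suc n)) - of_nat (Suc n) :: complex) ^ Suc m / fact m"
  proof (rule complex_Taylor)
    show "convex S" by (simp add: S_def)
    fix i z assume z: "z \<in> S"
    then obtain x where x: "x \<ge> real (Suc n)" "z = of_real x" using S by blast
    hence "z \<notin> \<real>\<^sub>\<le>\<^sub>0" by (auto simp: nonpos_Reals_of_real_iff)
    \<comment> \<open>Differentiation produces the factor \<open>1 - s - of_nat i\<close>; the
      absorption identity for binomials turns it into the step from \<open>f i\<close> to
      \<open>f (Suc i)\<close>.\<close>
    have "of_nat (Suc i) * ((1 - s) gchoose Suc i) = (1 - s - of_nat i) * ((1 - s) gchoose i)"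
      unfolding gbinomial_absorption gbinomial_absorb_comp ..
    hence *: "fact i * ((1 - s) gchoose i) * (1 - s - of_nat i) = fact (Suc i) * ((1 - s) gchoose Suc i)"
      by (simp only: fact_Suc mult_ac)
    have "(f i has_field_derivative
        fact i * ((1 - s) gchoose i) * ((1 - s - of_nat i) * z powr (1 - s - of_nat i - 1))) (at z)"
      unfolding f_def using \<open>z \<notin> \<real>\<^sub>\<le>\<^sub>0\<close> by (intro DERIV_cmult has_field_derivative_powr)
    also have "fact i * ((1 - s) gchoose i) * ((1 - s - of_nat i) * z powr (1 - s - of_nat i - 1)) = f (Suc i) z"
      unfolding f_def * [symmetric] by (simp add: algebra_simps)
    finally show "(f i has_field_derivative f (Suc i) z) (at z within S)"
      by (rule has_field_derivative_at_within)
  next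
    fix z assume "z \<in> S"
    then obtain x where x: "x \<ge> real (Suc n)" "z = of_real x" using S by blast
    hence "norm (z powr (1 - s - of_nat (Suc m))) = x powr (- Re s - real m)"
      by (subst norm_powr_real_powr) auto
    also have "\<dots> \<le> real (Suc n) powr (- Re s - real m)"
      using x assms by (intro powr_mono2') auto
    finally show "norm (f (Suc m) z) \<le> B"
      unfolding f_def B_def norm_mult norm_fact by (intro mult_left_mono) auto
  qed (auto simp: S_def)
  also have "f 0 (of_nat (Suc (Suc n))) -
      (\<Sum>i\<le>m. f i (of_nat (Suc n)) * (of_nat (Suc (Suc n)) - of_nat (Suc n)) ^ i / fact i) = zeta_rem m n s"
    by (simp add: f_def zeta_rem_def)
  also have "B * norm (of_nat (Suc (Suc n)) - of_nat (Suc n) :: complex) ^ Suc m / fact m =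
     real (Suc m) * norm ((1 - s) gchoose Suc m) * real (Suc n) powr (- Re s - real m)"
    by (simp add: B_def)
  finally show ?thesis .
qed

section \<open>Convergence and holomorphy of the remainder series\<close>

lemma summable_Suc_powr: "a < - 1 \<Longrightarrow> summable (\<lambda>n. real (Suc n) powr a)"
  using summable_real_powr_iff[of a] by (subst summable_Suc_iff) auto

lemma summable_zeta_rem:
  assumes "Re s > 1 - real m"
  shows "summable (\<lambda>n. zeta_rem m n s)"
  by (rule summable_comparison_test'[OF summable_mult[OF summable_Suc_powr] norm_zeta_rem_le])
     (use assms in auto)

lemma holomorphic_gchoose [holomorphic_intros]:
  "f holomorphic_on A \<Longrightarrow> (\<lambda>s. f s gchoose k) holomorphic_on A"
  unfolding gbinomial_prod_rev by (auto intro!: holomorphic_intros)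

text \<open>Weierstrass M-test on small closed discs: there \<open>C\<close> is bounded by
  compactness and the exponent is at most \<open>- 1 - d\<close>, so the majorant is
  summable.\<close>

lemma holomorphic_suminf_half_plane:
  fixes f :: "nat \<Rightarrow> complex \<Rightarrow> complex" and C :: "complex \<Rightarrow> real"
  assumes "\<And>n. f n holomorphic_on {s. Re s > c}"
  and "continuous_on {s. Re s > c} C"
  and bound: "\<And>n s. Re s > c \<Longrightarrow> norm (f n s) \<le> C s * real (Suc n) powr (c - 1 - Re s)"
  shows "(\<lambda>s. \<Sum>n. f n s) holomorphic_on {s. Re s > c}"
proof (rule holomorphic_uniform_sequence[where f = "\<lambda>n s. \<Sum>i<n. f i s"])
  show "open {s. Re s > c}" by (rule open_halfspace_Re_gt)
  show "(\<lambda>s. \<Sum>i<n. f i s) holomorphic_on {s. Re s > c}" for n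
    by (intro holomorphic_intros assms)
  fix z assume z: "z \<in> {s. Re s > c}"
  \<comment> \<open>Half the distance to the boundary line, so that the disc stays at distance
    \<open>d\<close> from it.\<close>
  define d where "d = (Re z - c) / 2"
  have d: "d > 0" using z by (simp add: d_def)
  have d2: "2 * d = Re z - c" by (simp add: d_def)
  have re: "Re s \<ge> c + d" if "s \<in> cball z d" for s
  proof -
    have "Re z - Re s \<le> norm (z - s)" using complex_Re_le_cmod[of "z - s"] by simp
    also have "\<dots> \<le> d" using that by (simp add: dist_norm)
    finally show ?thesis using d2 by linarith
  qed
  have sub: "cball z d \<subseteq> {s. Re s > c}"
  proof
    fix s assume "s \<in> cball z d"
    thus "s \<in> {s. Re s > c}" using re[of s] d by simp
  qed
  have "compact (C ` cball z d)"
    by (intro compact_continuous_image continuous_on_subset[OF assms(2) sub]) simp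
  hence "bounded (C ` cball z d)" by (rule compact_imp_bounded)
  then obtain K where K: "\<And>s. s \<in> cball z d \<Longrightarrow> norm (C s) \<le> K"
    by (force simp: bounded_iff)
  have K0: "K \<ge> 0" using K[of z] d abs_ge_zero[of "C z"] by (simp del: abs_ge_zero)
  have "uniform_limit (cball z d) (\<lambda>n s. \<Sum>i<n. f i s) (\<lambda>s. \<Sum>n. f n s) sequentially"
  proof (rule Weierstrass_m_test)
    fix n s assume s: "s \<in> cball z d"
    have "norm (f n s) \<le> C s * real (Suc n) powr (c - 1 - Re s)"
      using s sub by (intro bound) auto
    also have "\<dots> \<le> K * real (Suc n) powr (- 1 - d)"
      using K[OF s] K0 re[OF s] by (intro mult_mono powr_mono) auto
    finally show "norm (f n s) \<le> K * real (Suc n) powr (- 1 - d)" .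
  next
    show "summable (\<lambda>n. K * real (Suc n) powr (- 1 - d))"
      using d by (intro summable_mult summable_Suc_powr) auto
  qed
  with d sub show "\<exists>d>0. cball z d \<subseteq> {s. Re s > c} \<and>
     uniform_limit (cball z d) (\<lambda>n s. \<Sum>i<n. f i s) (\<lambda>s. \<Sum>n. f n s) sequentially" by (intro exI[of _ d] conjI)
qed

lemma holomorphic_suminf_zeta_rem:
  "(\<lambda>s. \<Sum>n. zeta_rem m n s) holomorphic_on {s. Re s > 1 - real m}"
proof (rule holomorphic_suminf_half_plane)
  show "zeta_rem m n holomorphic_on {s. Re s > 1 - real m}" for n
    unfolding zeta_rem_def by (auto intro!: holomorphic_intros)
  show "continuous_on {s. Re s > 1 - real m} (\<lambda>s. real (Suc m) * norm ((1 - s) gchoose Suc m))"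
    by (intro continuous_intros holomorphic_on_imp_continuous_on holomorphic_intros)
  fix n s assume s: "Re s > 1 - real m"
  have e: "1 - real m - 1 - Re s = - Re s - real m" by simp
  show "norm (zeta_rem m n s) \<le> real (Suc m) * norm ((1 - s) gchoose Suc m) *
      real (Suc n) powr (1 - real m - 1 - Re s)"
    unfolding e using s by (intro norm_zeta_rem_le) simp
qed

section \<open>A recurrence for the Dirichlet series\<close>

lemma sums_dirichlet_zeta:
  assumes "Re s > 1"
  shows "(\<lambda>n. of_nat (Suc n) powr (- s)) sums dirichlet_zeta s"
proof -
  have "summable (\<lambda>n. norm (of_nat (Suc n) powr (- s)))"
    unfolding norm_of_nat_Suc_powr using assms by (intro summable_Suc_powr) auto
  thus ?thesis unfolding dirichlet_zeta_def by (rule summable_norm_cancel[THEN summable_sums])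
qed

lemma tendsto_of_nat_powr_0:
  assumes "Re s < 0"
  shows "(\<lambda>n. of_nat (Suc n) powr s :: complex) \<longlonglongrightarrow> 0"
proof -
  have "(\<lambda>n. real n powr Re s) \<longlonglongrightarrow> 0"
    using assms tendsto_neg_powr[OF _ filterlim_real_sequentially] by blast
  hence "(\<lambda>n. real (Suc n) powr Re s) \<longlonglongrightarrow> 0"
    by (subst filterlim_sequentially_Suc)
  thus ?thesis
    by (subst tendsto_norm_zero_iff[symmetric]) (simp only: norm_of_nat_Suc_powr)
qed

text \<open>Exposes the factor \<open>s + of_nat j - 2\<close>, that is, the argument
  \<open>s + of_nat j - 1\<close> minus 1; it cancels the pole when \<open>z\<close> is the zeta
  value at that argument.\<close>

lemma gchoose_mult_shifted:
  fixes s z :: complex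
  assumes "j \<ge> 1"
  shows "((1 - s) gchoose j) * z =
    - (((1 - s) gchoose (j - 1)) / of_nat j * ((s + of_nat j - 2) * z))"
proof -
  obtain i where j: "j = Suc i" using assms by (cases j) auto
  have "of_nat j * ((1 - s) gchoose j) = (1 - s - of_nat i) * ((1 - s) gchoose i)"
    unfolding j gbinomial_absorption gbinomial_absorb_comp ..
  hence 1: "((1 - s) gchoose j) = (1 - s - of_nat i) * ((1 - s) gchoose i) / of_nat j"
    using assms by (metis nonzero_mult_div_cancel_left not_one_le_zero of_nat_eq_0_iff)
  have 2: "s + of_nat j - 2 = - (1 - s - of_nat i)" and 3: "j - 1 = i" by (simp_all add: j)
  show ?thesis unfolding 1 2 3 by (simp del: minus_diff_eq)
qed

text \<open>Summing the Taylor expansions over \<open>n\<close> telescopes the left-hand side. In the term with index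
  \<open>j\<close>, the pole of \<open>zeta (s + j - 1)\<close> is cancelled by the last factor of the binomial coefficient,
  so the right-hand side continues \<open>(s - 1) * zeta s\<close> one unit further to the left.\<close>

lemma dirichlet_zeta_recurrence:
  assumes s: "Re s > 1" and "m \<ge> 1"
  shows "(s - 1) * dirichlet_zeta s = 1 + (\<Sum>n. zeta_rem m n s)
     - (\<Sum>j=2..m. ((1 - s) gchoose (j - 1)) / of_nat j *
          ((s + of_nat j - 2) * dirichlet_zeta (s + of_nat j - 1)))"
proof -
  define Y where "Y = (\<Sum>j=2..m. ((1 - s) gchoose (j - 1)) / of_nat j *
          ((s + of_nat j - 2) * dirichlet_zeta (s + of_nat j - 1)))"
  \<comment> \<open>The limit is \<open>0\<close> because \<open>Re (1 - s) < 0\<close>, and the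
    initial term is 1.\<close>
  have "(\<lambda>n. of_nat (Suc (Suc n)) powr (1 - s) - of_nat (Suc n) powr (1 - s)) sums
      (0 - of_nat (Suc 0) powr (1 - s))"
    by (rule telescope_sums[OF tendsto_of_nat_powr_0]) (use s in auto)
  moreover have "(\<lambda>n. \<Sum>j=1..m. ((1 - s) gchoose j) * of_nat (Suc n) powr (- (s + of_nat j - 1))) sums
     (\<Sum>j=1..m. ((1 - s) gchoose j) * dirichlet_zeta (s + of_nat j - 1))"
    using s by (intro sums_sum sums_mult sums_dirichlet_zeta) auto
  ultimately have "(\<lambda>n. of_nat (Suc (Suc n)) powr (1 - s) - of_nat (Suc n) powr (1 - s) -
       (\<Sum>j=1..m. ((1 - s) gchoose j) * of_nat (Suc n) powr (- (s + of_nat j - 1)))) sums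
     (0 - of_nat (Suc 0) powr (1 - s) -
       (\<Sum>j=1..m. ((1 - s) gchoose j) * dirichlet_zeta (s + of_nat j - 1)))" (is "?f sums ?r")
    by (rule sums_diff)
  moreover have "?f = (\<lambda>n. zeta_rem m n s)"
    unfolding zeta_rem_def atMost_atLeast0 sum.atLeast_Suc_atMost[OF le0]
    by (simp add: algebra_simps)
  ultimately have "(\<Sum>n. zeta_rem m n s) = ?r" by (simp add: sums_iff)
  \<comment> \<open>The term \<open>j = 1\<close> carries \<open>dirichlet_zeta s\<close> itself;
    the later ones involve only arguments further to the right.\<close>
  also have "(\<Sum>j=1..m. ((1 - s) gchoose j) * dirichlet_zeta (s + of_nat j - 1)) =
     (1 - s) * dirichlet_zeta s + (\<Sum>j=2..m. ((1 - s) gchoose j) * dirichlet_zeta (s + of_nat j - 1))"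
    using assms(2) by (subst sum.atLeast_Suc_atMost) (auto simp: numeral_2_eq_2)
  also have "(\<Sum>j=2..m. ((1 - s) gchoose j) * dirichlet_zeta (s + of_nat j - 1)) = - Y"
    unfolding Y_def sum_negf[symmetric]
    by (intro sum.cong refl gchoose_mult_shifted) auto
  finally have "(\<Sum>n. zeta_rem m n s) = 0 - 1 - ((1 - s) * dirichlet_zeta s - Y)"
    by simp
  thus ?thesis unfolding Y_def[symmetric] by algebra
qed

section \<open>Continuation to the whole plane and the resulting facts about
  \<open>zeta\<close>\<close>

text \<open>Induction on \<open>m\<close>: in the recurrence the terms \<open>j \<ge> 2\<close>
  evaluate \<open>G\<close> at least one unit to the right of \<open>s\<close>, so a continuation to
  \<open>Re s > - m\<close> yields one to \<open>Re s > - m - 1\<close>.\<close>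

lemma zeta_continuation_half_plane:
  "\<exists>G. G holomorphic_on {s. Re s > - real m} \<and> (\<forall>s. Re s > 1 \<longrightarrow> G s = (s - 1) * dirichlet_zeta s)"
proof (induction m)
  case 0
  have "(\<lambda>s. 1 + (\<Sum>n. zeta_rem 1 n s)) holomorphic_on {s. Re s > 0}"
    using holomorphic_suminf_zeta_rem[of 1] by (auto intro!: holomorphic_intros)
  moreover have "\<forall>s. Re s > 1 \<longrightarrow> 1 + (\<Sum>n. zeta_rem 1 n s) = (s - 1) * dirichlet_zeta s"
    using dirichlet_zeta_recurrence[of _ 1] by simp
  ultimately show ?case
    by (intro exI[of _ "\<lambda>s. 1 + (\<Sum>n. zeta_rem 1 n s)"]) simp
next
  case (Suc m)
  then obtain G where G: "G holomorphic_on {s. Re s > - real m}"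
    "\<And>s. Re s > 1 \<Longrightarrow> G s = (s - 1) * dirichlet_zeta s" by blast
  \<comment> \<open>The remainder series of order \<open>M\<close> is holomorphic for
    \<open>Re s > 1 - M\<close>, which is exactly the next half-plane.\<close>
  define M where "M = Suc (Suc m)"
  define H where "H = (\<lambda>s. 1 + (\<Sum>n. zeta_rem M n s)
     - (\<Sum>j=2..M. ((1 - s) gchoose (j - 1)) / of_nat j * G (s + of_nat j - 1)))"
  have "(\<lambda>s. G (s + of_nat j - 1)) holomorphic_on {s. Re s > - real (Suc m)}" if "j \<in> {2..M}" for j
    using that by (intro holomorphic_on_compose_gen[OF _ G(1), unfolded o_def] holomorphic_intros) auto
  hence "H holomorphic_on {s. Re s > - real (Suc m)}"
    unfolding H_def using holomorphic_suminf_zeta_rem[of M]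
    by (intro holomorphic_intros) (auto simp: M_def)
  moreover have "H s = (s - 1) * dirichlet_zeta s" if "Re s > 1" for s
  proof -
    have "G (s + of_nat j - 1) = (s + of_nat j - 2) * dirichlet_zeta (s + of_nat j - 1)"
      if "j \<in> {2..M}" for j
      using that \<open>Re s > 1\<close> by (subst G(2)) (auto simp: algebra_simps)
    thus ?thesis unfolding H_def using that
      by (subst dirichlet_zeta_recurrence[of s M]) (auto simp: M_def)
  qed
  ultimately show ?case by blast
qed

text \<open>The half-plane continuations of \<open>(s - 1) * dirichlet_zeta s\<close> are glued into
  an entire function by the identity theorem, which is then divided by \<open>s - 1\<close>. The
  choice operator in \<open>zeta\<close> yields its properties only through such a witness.\<close>

lemma zeta_exists:
  "\<exists>f. f holomorphic_on (- {1}) \<and>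
     (\<forall>s. Re s > 1 \<longrightarrow> (\<lambda>n. of_nat (Suc n) powr (- s)) sums f s)"
proof -
  define G where "G = (\<lambda>m::nat. SOME G. G holomorphic_on {s. Re s > - real m} \<and>
      (\<forall>s. Re s > 1 \<longrightarrow> G s = (s - 1) * dirichlet_zeta s))"
  have "G m holomorphic_on {s. Re s > - real m} \<and>
      (\<forall>s. Re s > 1 \<longrightarrow> G m s = (s - 1) * dirichlet_zeta s)" for m
    unfolding G_def by (rule someI_ex[OF zeta_continuation_half_plane])
  hence G: "G m holomorphic_on {s. Re s > - real m}"
      "Re s > 1 \<Longrightarrow> G m s = (s - 1) * dirichlet_zeta s" for m s
    by auto
  have eq: "G m s = G n s" if "m \<le> n" "Re s > - real m" for m n s
  proof (rule analytic_continuation_open[of "{s. Re s > 1}" "{s. Re s > - real m}" "G m" "G n"])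
    show "{s. Re s > 1} \<noteq> {}" by (auto intro!: exI[of _ 2])
    show "G n holomorphic_on {s. Re s > - real m}"
      using that by (intro holomorphic_on_subset[OF G(1)]) auto
  qed (use that G in \<open>auto intro!: open_halfspace_Re_gt convex_connected convex_halfspace_Re_gt\<close>)
  \<comment> \<open>\<open>N s\<close> exceeds \<open>norm s\<close>, so \<open>s\<close> lies in
    the half-plane with this index.\<close>
  define N where "N = (\<lambda>s::complex. Suc (nat \<lceil>norm s\<rceil>))"
  define H where "H = (\<lambda>s. G (N s) s)"
  have N: "Re s > - real (N s)" for s
    unfolding N_def using abs_Re_le_cmod[of s] by linarith
  have H: "H s = G m s" if "Re s > - real m" for m s
    using eq[of m "N s" s, OF _ that] eq[of "N s" m s, OF _ N] nat_le_linear[of m "N s"]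
    unfolding H_def by metis
  have "H field_differentiable at z" for z
  proof -
    \<comment> \<open>Around \<open>z\<close> the varying index may be frozen at
      \<open>N z\<close>.\<close>
    have "H holomorphic_on {s. Re s > - real (N z)}"
      by (rule holomorphic_transform[OF G(1)]) (simp add: H)
    thus ?thesis
      using N[of z] by (intro holomorphic_on_imp_differentiable_at) (auto simp: open_halfspace_Re_gt)
  qed
  hence "H holomorphic_on A" for A
    by (simp add: field_differentiable_at_within holomorphic_on_def)
  hence "(\<lambda>s. H s / (s - 1)) holomorphic_on (- {1})"
    by (intro holomorphic_intros) auto
  moreover have "(\<lambda>n. of_nat (Suc n) powr (- s)) sums (H s / (s - 1))" if "Re s > 1" for s
  proof -
    have "H s / (s - 1) = dirichlet_zeta s"
      using that H[of 0 s] G(2)[of s 0] by auto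
    thus ?thesis using sums_dirichlet_zeta[OF that] by simp
  qed
  ultimately show ?thesis by blast
qed

lemma zeta_spec:
  "zeta holomorphic_on (- {1}) \<and> (\<forall>s. Re s > 1 \<longrightarrow> (\<lambda>n. of_nat (Suc n) powr (- s)) sums zeta s)"
  unfolding zeta_def by (rule someI_ex[OF zeta_exists])

lemma holomorphic_zeta: "zeta holomorphic_on (- {1})"
  and zeta_eq_dirichlet_zeta: "Re s > 1 \<Longrightarrow> zeta s = dirichlet_zeta s"
  using zeta_spec by (simp_all add: dirichlet_zeta_def sums_iff)

text \<open>Both sides are holomorphic for \<open>Re s > 0\<close> and \<open>Im s > 0\<close>, a
  connected open set avoiding the pole at 1, and they agree for \<open>Re s > 1\<close> by the
  recurrence with \<open>m = 1\<close>.\<close>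

lemma zeta_eq_suminf_rem:
  assumes "Re s > 0" "Im s > 0"
  shows "(s - 1) * zeta s = 1 + (\<Sum>n. zeta_rem 1 n s)"
proof (rule analytic_continuation_open[of "{s. Re s > 1} \<inter> {s. Im s > 0}" "{s. Re s > 0} \<inter> {s. Im s > 0}"
    "\<lambda>s. (s - 1) * zeta s" "\<lambda>s. 1 + (\<Sum>n. zeta_rem 1 n s)"])
  have "1 + (1 + \<i>) \<in> {s. Re s > 1} \<inter> {s. Im s > 0}" by simp
  thus "{s. Re s > 1} \<inter> {s. Im s > 0} \<noteq> {}" by blast
  show "(\<lambda>s. (s - 1) * zeta s) holomorphic_on {s. Re s > 0} \<inter> {s. Im s > 0}"
    by (intro holomorphic_intros holomorphic_on_subset[OF holomorphic_zeta]) auto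
  show "(\<lambda>s. 1 + (\<Sum>n. zeta_rem 1 n s)) holomorphic_on {s. Re s > 0} \<inter> {s. Im s > 0}"
    by (intro holomorphic_intros holomorphic_on_subset[OF holomorphic_suminf_zeta_rem]) auto
  show "connected ({s. Re s > 0} \<inter> {s. Im s > 0})"
    by (intro convex_connected convex_Int convex_halfspace_Re_gt convex_halfspace_Im_gt)
  fix s assume "s \<in> {s. Re s > 1} \<inter> {s. Im s > 0}"
  thus "(s - 1) * zeta s = 1 + (\<Sum>n. zeta_rem 1 n s)"
    using dirichlet_zeta_recurrence[of s 1] zeta_eq_dirichlet_zeta[of s] by simp
qed (use assms in \<open>auto intro!: open_Int open_halfspace_Re_gt open_halfspace_Im_gt\<close>)

lemma continuous_on_zeta_crit: "continuous_on A zeta_crit"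
proof -
  have "continuous_on (- {1}) zeta"
    using holomorphic_zeta by (rule holomorphic_on_imp_continuous_on)
  thus ?thesis unfolding zeta_crit_def
    by (rule continuous_on_compose2[where f = "\<lambda>t. 1/2 + \<i> * complex_of_real t"])
       (auto intro!: continuous_intros simp: complex_eq_iff)
qed

section \<open>A lower bound for the second moment on the critical line\<close>

text \<open>Comparison with an antiderivative, so that the tail of the remainder bounds telescopes.
  The right-hand side equals
  \<open>2 / (sqrt (x + 1) * (sqrt x * (sqrt x + sqrt (x + 1))))\<close>.\<close>

lemma powr_le_diff_inverse_sqrt:
  fixes x :: real assumes "x > 0"
  shows "(x + 1) powr (- 3 / 2) \<le> 2 / sqrt x - 2 / sqrt (x + 1)"
proof -
  have *: "(x + 1) powr (- 3 / 2) = 1 / ((x + 1) * sqrt (x + 1))"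
  proof -
    have "(x + 1) powr (3 / 2) = (x + 1) powr 1 * (x + 1) powr (1 / 2)"
      unfolding powr_add[symmetric] by simp
    thus ?thesis using assms by (simp add: powr_minus_divide powr_half_sqrt)
  qed
  have "sqrt x * (sqrt x + sqrt (x + 1)) \<le> sqrt (x + 1) * (2 * sqrt (x + 1))"
    using assms by (intro mult_mono) (auto intro: add_nonneg_nonneg order.trans[OF add_mono])
  also have "\<dots> = 2 * (sqrt (x + 1) * sqrt (x + 1))" by (simp only: mult_ac)
  also have "\<dots> = 2 * (x + 1)" using assms by (simp only: real_sqrt_mult_self)
  finally have "2 / (sqrt (x + 1) * (2 * (x + 1))) \<le> 2 / (sqrt (x + 1) * (sqrt x * (sqrt x + sqrt (x + 1))))"
    using assms by (intro divide_left_mono mult_left_mono mult_pos_pos) (auto intro: add_pos_pos)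
  also have "\<dots> = 2 / sqrt x - 2 / sqrt (x + 1)"
  proof -
    have "(sqrt (x + 1) - sqrt x) * (sqrt x + sqrt (x + 1)) = 1"
      using assms by (simp add: algebra_simps)
    moreover have "sqrt x > 0" "sqrt (x + 1) > 0" "sqrt x + sqrt (x + 1) > 0"
      using assms by (auto intro: add_pos_pos)
    ultimately show ?thesis by (simp add: divide_simps) (simp add: algebra_simps)
  qed
  finally have "2 / (2 * ((x + 1) * sqrt (x + 1))) \<le> 2 / sqrt x - 2 / sqrt (x + 1)"
    by (simp only: mult_ac)
  moreover have "2 / (2 * y) = 1 / y" for y :: real by simp
  ultimately show ?thesis unfolding * by (simp only:)
qed

text \<open>Each term is at most the corresponding increment of \<open>2 * sqrt\<close>, by the
  arithmetic-geometric mean inequality.\<close>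

lemma sum_inverse_sqrt_le: "(\<Sum>n=1..<M. 1 / sqrt (real (Suc n))) \<le> 2 * sqrt (real M)"
proof (induction M)
  case (Suc M)
  have "1 / sqrt (real (Suc M)) \<le> 2 * (sqrt (real (Suc M)) - sqrt (real M))"
  proof -
    have "2 * (sqrt (real (Suc M)) * sqrt (real M)) \<le> real (Suc M) + real M"
      using sum_squares_bound[of "sqrt (real (Suc M))" "sqrt (real M)"] by (simp add: mult_ac)
    moreover have "sqrt (real (Suc M)) * sqrt (real (Suc M)) = real M + 1" by simp
    ultimately show ?thesis
      by (subst pos_divide_le_eq) (simp_all add: algebra_simps del: real_sqrt_mult_self)
  qed
  note step = this
  have "(\<Sum>n=1..<Suc M. 1 / sqrt (real (Suc n))) \<le>
      (\<Sum>n=1..<M. 1 / sqrt (real (Suc n))) + 1 / sqrt (real (Suc M))"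
    by (cases M) auto
  also have "\<dots> \<le> 2 * sqrt (real M) + 2 * (sqrt (real (Suc M)) - sqrt (real M))"
    by (intro add_mono Suc.IH step)
  finally show ?case by simp
qed auto

text \<open>The logarithm gains an arbitrarily small factor over the plain sum: beyond
  \<open>K\<close> it is large, and the finitely many earlier terms are absorbed as \<open>M\<close>
  grows. The sum starts at \<open>n = 1\<close> because \<open>ln 1 = 0\<close>.\<close>

lemma eventually_sum_inverse_sqrt_ln_le:
  assumes "\<epsilon> > 0"
  shows "\<forall>\<^sub>F M in sequentially.
    (\<Sum>n=1..<M. 1 / (sqrt (real (Suc n)) * ln (real (Suc n)))) \<le> \<epsilon> * sqrt (real M)"
proof -
  define K where "K = nat \<lceil>exp (4 / \<epsilon>)\<rceil> + 1"
  have "exp (4 / \<epsilon>) \<le> real K" unfolding K_def by linarith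
  have K: "ln (real (Suc n)) \<ge> 4 / \<epsilon>" if "n \<ge> K" for n
  proof -
    have "exp (4 / \<epsilon>) \<le> real (Suc n)" using that \<open>exp (4 / \<epsilon>) \<le> real K\<close> by linarith
    thus ?thesis by (subst ln_ge_iff) auto
  qed
  \<comment> \<open>With this threshold the early terms, at most \<open>2 * K\<close> in total, use
    half of the target; the others use the rest, as \<open>\<epsilon> / 4\<close> times
    \<open>2 * sqrt M\<close>.\<close>
  have "\<forall>\<^sub>F M in sequentially. real M \<ge> (4 * real K / \<epsilon>)\<^sup>2"
    using filterlim_real_sequentially by (simp add: filterlim_at_top)
  thus ?thesis
  proof eventually_elim
    case (elim M)
    hence "sqrt (real M) \<ge> 4 * real K / \<epsilon>"
      by (intro real_le_rsqrt)
    hence KM: "2 * real K \<le> \<epsilon> / 2 * sqrt (real M)" using assms by (simp add: field_simps)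
    have "(\<Sum>n=1..<M. 1 / (sqrt (real (Suc n)) * ln (real (Suc n)))) \<le>
        (\<Sum>n=1..<M. (if n < K then 2 else 0) + \<epsilon> / 4 * (1 / sqrt (real (Suc n))))"
    proof (intro sum_mono)
      fix n assume n: "n \<in> {1..<M}"
      have ln2: "ln 2 \<le> ln (real (Suc n))" using n by (subst ln_le_cancel_iff) auto
      show "1 / (sqrt (real (Suc n)) * ln (real (Suc n))) \<le>
        (if n < K then 2 else 0) + \<epsilon> / 4 * (1 / sqrt (real (Suc n)))"
      proof (cases "n < K")
        case True
        have "1 / 2 \<le> ln (real (Suc n))" using ln2 ln2_ge_two_thirds by linarith
        hence "1 * (1 / 2) \<le> sqrt (real (Suc n)) * ln (real (Suc n))"
          by (intro mult_mono) auto
        hence "1 / (sqrt (real (Suc n)) * ln (real (Suc n))) \<le> 1 / (1 / 2)"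
          by (intro divide_left_mono) auto
        moreover have "\<epsilon> / 4 * (1 / sqrt (real (Suc n))) \<ge> 0" using assms by simp
        ultimately show ?thesis using True by simp
      next
        case False
        have "1 / (sqrt (real (Suc n)) * ln (real (Suc n))) \<le> 1 / (sqrt (real (Suc n)) * (4 / \<epsilon>))"
          using K[of n] False assms ln2 ln2_ge_two_thirds
          by (intro divide_left_mono mult_left_mono mult_pos_pos) auto
        thus ?thesis using False by (simp add: field_simps)
      qed
    qed
    also have "\<dots> = (\<Sum>n=1..<M. if n < K then 2 else 0) + \<epsilon> / 4 * (\<Sum>n=1..<M. 1 / sqrt (real (Suc n)))"
      by (simp only: sum.distrib sum_distrib_left)
    also have "(\<Sum>n=1..<M. if n < K then 2 else 0::real) \<le> (\<Sum>n<K. 2)"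
      unfolding sum.inter_filter[symmetric, OF finite_atLeastLessThan] by (intro sum_mono2) auto
    also have "(\<Sum>n<K. 2::real) = 2 * real K" by simp
    also have "\<epsilon> / 4 * (\<Sum>n=1..<M. 1 / sqrt (real (Suc n))) \<le> \<epsilon> / 4 * (2 * sqrt (real M))"
      using assms by (intro mult_left_mono sum_inverse_sqrt_le) auto
    finally show ?case using KM by linarith
  qed
qed

section \<open>Finite approximation on the critical line and its integral\<close>

lemma sum_zeta_rem_1:
  "(\<Sum>n<M. zeta_rem 1 n s) = of_nat (Suc M) powr (1 - s) - 1
     + (s - 1) * (\<Sum>n<M. of_nat (Suc n) powr (- s))"
  by (induction M) (simp_all add: zeta_rem_def algebra_simps)

text \<open>The difference is the tail of the remainder series from index \<open>M\<close>. On the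
  critical line its terms are bounded by |s|^2 times a power with exponent -3/2, and these bounds
  telescope.\<close>

lemma norm_zeta_partial_sum_diff_le:
  assumes "Re s = 1 / 2" "Im s > 0" "M > 0"
  shows "norm ((s - 1) * zeta s - (of_nat (Suc M) powr (1 - s)
     + (s - 1) * (\<Sum>n<M. of_nat (Suc n) powr (- s)))) \<le> 2 * (norm s)\<^sup>2 / sqrt (real M)"
proof -
  have "(\<lambda>n. 2 / sqrt (real n)) \<longlonglongrightarrow> 0"
    by real_asymp
  hence "(\<lambda>n. 2 / sqrt (real (n + M))) \<longlonglongrightarrow> 0"
    by (rule LIMSEQ_ignore_initial_segment)
  from telescope_sums'[OF this]
  have tele: "(\<lambda>n. (norm s)\<^sup>2 * (2 / sqrt (real (n + M)) - 2 / sqrt (real (Suc n + M)))) sums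
     ((norm s)\<^sup>2 * (2 / sqrt (real (0 + M)) - 0))"
    by (rule sums_mult)
  have "summable (\<lambda>n. zeta_rem 1 n s)" using assms by (intro summable_zeta_rem) auto
  hence "(s - 1) * zeta s = 1 + ((\<Sum>n. zeta_rem 1 (n + M) s) + (\<Sum>n<M. zeta_rem 1 n s))"
    using assms zeta_eq_suminf_rem[of s] suminf_split_initial_segment[of "\<lambda>n. zeta_rem 1 n s" M] by simp
  hence "(s - 1) * zeta s - (of_nat (Suc M) powr (1 - s)
     + (s - 1) * (\<Sum>n<M. of_nat (Suc n) powr (- s))) = (\<Sum>n. zeta_rem 1 (n + M) s)"
    unfolding sum_zeta_rem_1 by (simp add: algebra_simps)
  also have "norm \<dots> \<le> (\<Sum>n. (norm s)\<^sup>2 * (2 / sqrt (real (n + M)) - 2 / sqrt (real (Suc n + M))))"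
  proof (rule norm_suminf_le)
    fix n
    have g: "(1 - s) gchoose Suc 1 = (1 - s) * (- s) / 2"
      by (simp add: gbinomial_prod_rev numeral_2_eq_2)
    \<comment> \<open>On the critical line \<open>1 - s\<close> is the conjugate of
      \<open>s\<close>.\<close>
    have "norm (1 - s) = norm s"
      unfolding cmod_def using assms(1) by simp
    hence g2: "real (Suc 1) * norm ((1 - s) gchoose Suc 1) = (norm s)\<^sup>2"
      unfolding g by (simp add: norm_mult norm_divide power2_eq_square)
    have "norm (zeta_rem 1 (n + M) s) \<le> (norm s)\<^sup>2 * real (Suc (n + M)) powr (- Re s - real 1)"
      unfolding g2[symmetric] by (rule norm_zeta_rem_le) (simp add: assms(1))
    also have "- Re s - real 1 = - 3 / 2" using assms by simp
    also have "real (Suc (n + M)) powr (- 3 / 2) \<le> 2 / sqrt (real (n + M)) - 2 / sqrt (real (Suc n + M))"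
      using powr_le_diff_inverse_sqrt[of "real (n + M)"] assms by (simp add: add_ac)
    finally show "norm (zeta_rem 1 (n + M) s) \<le>
        (norm s)\<^sup>2 * (2 / sqrt (real (n + M)) - 2 / sqrt (real (Suc n + M)))"
      by (simp add: mult_left_mono)
  next
    show "summable (\<lambda>n. (norm s)\<^sup>2 * (2 / sqrt (real (n + M)) - 2 / sqrt (real (Suc n + M))))"
      using tele by (rule sums_summable)
  qed
  also have "\<dots> = 2 * (norm s)\<^sup>2 / sqrt (real M)"
    unfolding sums_unique[OF tele, symmetric] by simp
  finally show ?thesis .
qed

text \<open>Explicit antiderivatives for the terms of the approximation; the second comes from
  integration by parts, whence \<open>1 / L\<^sup>2\<close>. The case \<open>n = 0\<close> is
  excluded since \<open>L\<close> would vanish.\<close>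

lemma has_vector_derivative_powr_critical:
  assumes "n > 0"
  defines "L \<equiv> complex_of_real (ln (real (Suc n)))" and "s \<equiv> \<lambda>t. 1 / 2 + \<i> * complex_of_real t"
  shows "((\<lambda>t. \<i> * of_nat (Suc n) powr (a - s t) / L) has_vector_derivative
           of_nat (Suc n) powr (a - s t)) (at t within A)" (is ?A)
    and "((\<lambda>t. \<i> * of_nat (Suc n) powr (- s t) * ((s t - 1) / L + 1 / L\<^sup>2)) has_vector_derivative
           (s t - 1) * of_nat (Suc n) powr (- s t)) (at t within A)" (is ?B)
proof -
  have L: "L \<noteq> 0" using assms by simp
  have powr_eq: "of_nat (Suc n) powr z = exp (z * L)" for z
    by (simp add: powr_def L_def Ln_of_nat del: of_nat_Suc)
  have "((\<lambda>t. \<i> * exp ((a - (1 / 2 + \<i> * t)) * L) / L) has_field_derivative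
          exp ((a - (1 / 2 + \<i> * complex_of_real t)) * L)) (at (complex_of_real t))"
    using L by (auto intro!: derivative_eq_intros simp: field_simps)
  thus ?A unfolding powr_eq s_def by (rule has_vector_derivative_real_field)
  have "((\<lambda>t. \<i> * exp (- (1 / 2 + \<i> * t) * L) * ((1 / 2 + \<i> * t - 1) / L + 1 / L\<^sup>2)) has_field_derivative
         (1 / 2 + \<i> * complex_of_real t - 1) * exp (- (1 / 2 + \<i> * complex_of_real t) * L)) (at (complex_of_real t))"
    using L by (auto intro!: derivative_eq_intros simp: field_simps power2_eq_square)
  thus ?B unfolding powr_eq s_def by (rule has_vector_derivative_real_field)
qed

text \<open>Integrate \<open>(s - 1) * zeta s\<close> over \<open>{T..2 * T}\<close>: the term
  \<open>n = 0\<close> contributes \<open>3 / 2 * T\<^sup>2\<close> to the imaginary part, which the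
  other terms and the tail cannot cancel. Hence |zeta| is not small in mean.\<close>

lemma eventually_integral_zeta_crit_sq_ge:
  "\<forall>\<^sub>F T in at_top. integral {T..2 * T} (\<lambda>t. (norm (zeta_crit t))\<^sup>2) \<ge> T / 16"
proof -
  \<comment> \<open>The length has order \<open>T\<^sup>2\<close>: then the tail of the expansion, of size \<open>T\<^sup>2 / sqrt M\<close>, is at most
    \<open>T / 4\<close>, while the terms with \<open>n \<ge> 1\<close> contribute only \<open>T * sqrt M / ln M\<close> after integration.\<close>
  define M where "M = (\<lambda>T::real. nat \<lceil>(40 * T)\<^sup>2\<rceil>)"
  have "filterlim M sequentially at_top"
    unfolding M_def filterlim_at_top
  proof (intro allI)
    fix Z :: nat
    show "\<forall>\<^sub>F T::real in at_top. Z \<le> nat \<lceil>(40 * T)\<^sup>2\<rceil>"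
      using eventually_ge_at_top[of "real Z + 1"]
    proof eventually_elim
      case (elim T)
      have "1 * T \<le> (40 * 40 * T) * T" using elim by (intro mult_right_mono) auto
      also have "\<dots> = (40 * T)\<^sup>2" by (simp add: power2_eq_square)
      finally have "real Z \<le> (40 * T)\<^sup>2" using elim by linarith
      thus ?case by linarith
    qed
  qed
  \<comment> \<open>984 is 3 times 41 times 8, so that the bound for the sum of the
    \<open>G n\<close> below becomes \<open>T\<^sup>2 / 8\<close>.\<close>
  from eventually_compose_filterlim[OF eventually_sum_inverse_sqrt_ln_le[of "1 / 984"] this]
  have "\<forall>\<^sub>F T in at_top. (\<Sum>n=1..<M T. 1 / (sqrt (real (Suc n)) * ln (real (Suc n)))) \<le> 1 / 984 * sqrt (real (M T))"
    by simp
  \<comment> \<open>The threshold serves chiefly for \<open>41 * T \<le> T\<^sup>2 / 8\<close>, that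
    is, \<open>T \<ge> 328\<close>.\<close>
  thus ?thesis using eventually_ge_at_top[of 400]
  proof eventually_elim
    case (elim T)
    note T = \<open>T \<ge> 400\<close>
    define s where "s = (\<lambda>t. 1 / 2 + \<i> * complex_of_real t)"
    define N where "N = M T"
    have "(40 * T)\<^sup>2 \<le> real N" "real N \<le> (40 * T)\<^sup>2 + 1"
      unfolding N_def M_def using zero_le_power2[of "40 * T"] by linarith+
    have N1: "40 * T \<le> sqrt (real N)" using \<open>(40 * T)\<^sup>2 \<le> real N\<close> by (rule real_le_rsqrt)
    \<comment> \<open>Passing from 40 to 41 absorbs the ceiling and the successor.\<close>
    have "(40 * T)\<^sup>2 + 1 + 1 \<le> (41 * T)\<^sup>2"
      using T mult_mono[OF T T] by (simp add: power2_eq_square)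
    hence N2: "sqrt (real (Suc N)) \<le> 41 * T"
      using \<open>real N \<le> _\<close> T by (intro real_le_lsqrt) auto
    have "sqrt (real N) \<le> sqrt (real (Suc N))" by simp
    hence N2': "sqrt (real N) \<le> 41 * T" using N2 by linarith
    have N0: "N > 2"
      using \<open>(40 * T)\<^sup>2 \<le> real N\<close> mult_mono[OF T T] T by (simp add: power2_eq_square)
    have re: "Re (s t) = 1 / 2" and im: "Im (s t) = t" for t by (simp_all add: s_def)
    have norm_s: "norm (s t) \<le> 1 / 2 + \<bar>t\<bar>" "norm (s t - 1) \<le> 1 / 2 + \<bar>t\<bar>" for t
      using cmod_le[of "s t"] cmod_le[of "s t - 1"] by (simp_all add: re im)
    define \<Phi>' where "\<Phi>' = (\<lambda>t. of_nat (Suc N) powr (1 - s t)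
        + (s t - 1) * (\<Sum>n<N. of_nat (Suc n) powr (- s t)))"
    define E where "E = (\<lambda>t. \<i> * of_nat (Suc N) powr (1 - s t) / complex_of_real (ln (real (Suc N))))"
    \<comment> \<open>Antiderivative of the term \<open>n = 0\<close>, which is
      \<open>s t - 1\<close> and has no logarithm to divide by.\<close>
    define F where "F = (\<lambda>t. - complex_of_real t / 2 + \<i> * (complex_of_real t)\<^sup>2 / 2)"
    define G where "G = (\<lambda>n t. \<i> * of_nat (Suc n) powr (- s t) *
       ((s t - 1) / complex_of_real (ln (real (Suc n))) + 1 / (complex_of_real (ln (real (Suc n))))\<^sup>2))"
    define \<Phi> where "\<Phi> = (\<lambda>t. E t + (F t + (\<Sum>n=1..<N. G n t)))"
    have "(\<Phi> has_vector_derivative \<Phi>' t) (at t within {T..2 * T})" for t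
    proof -
      have "(E has_vector_derivative of_nat (Suc N) powr (1 - s t)) (at t within {T..2 * T})"
        unfolding E_def s_def using N0 by (intro has_vector_derivative_powr_critical) auto
      moreover have "(F has_vector_derivative s t - 1) (at t within {T..2 * T})"
        unfolding F_def s_def
        by (rule has_vector_derivative_real_field) (auto intro!: derivative_eq_intros)
      moreover have "((\<lambda>t. \<Sum>n=1..<N. G n t) has_vector_derivative
          (\<Sum>n=1..<N. (s t - 1) * of_nat (Suc n) powr (- s t))) (at t within {T..2 * T})"
        unfolding G_def s_def
        by (intro has_vector_derivative_sum has_vector_derivative_powr_critical) auto
      ultimately have "(\<Phi> has_vector_derivative of_nat (Suc N) powr (1 - s t) + (s t - 1 +
          (\<Sum>n=1..<N. (s t - 1) * of_nat (Suc n) powr (- s t)))) (at t within {T..2 * T})"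
        unfolding \<Phi>_def by (intro has_vector_derivative_add)
      also have "s t - 1 + (\<Sum>n=1..<N. (s t - 1) * of_nat (Suc n) powr (- s t)) =
          (s t - 1) * (\<Sum>n<N. of_nat (Suc n) powr (- s t))"
        using N0 by (simp add: lessThan_atLeast0 sum.atLeast_Suc_lessThan sum_distrib_left distrib_left)
      finally show ?thesis unfolding \<Phi>'_def .
    qed
    hence int_\<Phi>': "(\<Phi>' has_integral \<Phi> (2 * T) - \<Phi> T) {T..2 * T}"
      using T by (intro fundamental_theorem_of_calculus) auto

    have norm_E: "norm (E t) \<le> T\<^sup>2 / 8" for t
    proof -
      have "exp 1 \<le> real (Suc N)" using exp_le N0 by linarith
      hence "1 \<le> ln (real (Suc N))" by (subst ln_ge_iff) auto
      hence "norm (E t) \<le> sqrt (real (Suc N)) / 1"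
        unfolding E_def norm_mult norm_divide norm_of_nat_Suc_powr
        by (intro frac_le) (auto simp: re powr_half_sqrt)
      also have "\<dots> \<le> 41 * T" using N2 by simp
      also have "\<dots> \<le> T\<^sup>2 / 8" using T by (simp add: power2_eq_square)
      finally show ?thesis .
    qed
    have norm_G: "norm (\<Sum>n=1..<N. G n t) \<le> T\<^sup>2 / 8" if "t \<in> {T..2 * T}" for t
    proof -
      have "norm (\<Sum>n=1..<N. G n t) \<le> (\<Sum>n=1..<N. 3 * T * (1 / (sqrt (real (Suc n)) * ln (real (Suc n)))))"
      proof (rule sum_norm_le)
        fix n assume n: "n \<in> {1..<N}"
        define l where "l = ln (real (Suc n))"
        have "ln 2 \<le> l" unfolding l_def using n by (subst ln_le_cancel_iff) auto
        hence l: "l \<ge> 1 / 2" using ln2_ge_two_thirds by linarith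
        have "norm (G n t) = (1 / sqrt (real (Suc n))) * norm ((s t - 1) / complex_of_real l + 1 / (complex_of_real l)\<^sup>2)"
          unfolding G_def norm_mult norm_of_nat_Suc_powr l_def
          by (simp add: re powr_minus_divide powr_half_sqrt del: of_nat_Suc)
        also have "norm ((s t - 1) / complex_of_real l + 1 / (complex_of_real l)\<^sup>2) \<le>
           norm (s t - 1) / l + 1 / l\<^sup>2"
          using l by (intro order_trans[OF norm_triangle_ineq]) (simp add: norm_divide norm_power)
        also have "\<dots> = (norm (s t - 1) + 1 / l) / l"
          using l by (simp add: field_simps power2_eq_square)
        also have "\<dots> \<le> (3 * T) / l"
        proof (intro divide_right_mono)
          have "1 / l \<le> 1 / (1 / 2)" using l by (intro divide_left_mono) auto
          thus "norm (s t - 1) + 1 / l \<le> 3 * T" using norm_s(2)[of t] that T by simp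
        qed (use l in auto)
        finally show "norm (G n t) \<le> 3 * T * (1 / (sqrt (real (Suc n)) * ln (real (Suc n))))"
          by (simp add: l_def mult_left_mono divide_right_mono)
      qed
      also have "\<dots> = 3 * T * (\<Sum>n=1..<N. 1 / (sqrt (real (Suc n)) * ln (real (Suc n))))"
        by (simp only: sum_distrib_left)
      also have "\<dots> \<le> 3 * T * (1 / 984 * (41 * T))"
        using elim(1) N2' T unfolding N_def[symmetric] by (intro mult_left_mono) auto
      also have "\<dots> = T\<^sup>2 / 8" by (simp add: power2_eq_square)
      finally show ?thesis .
    qed
    \<comment> \<open>The main term \<open>3 / 2 * T\<^sup>2\<close> loses at most four errors of
      \<open>T\<^sup>2 / 8\<close>, from \<open>E\<close> and from the sum of the \<open>G n\<close>
      at both ends.\<close>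
    have Im_\<Phi>: "Im (\<Phi> (2 * T) - \<Phi> T) \<ge> T\<^sup>2"
    proof -
      have "Im (F (2 * T)) - Im (F T) = 3 / 2 * T\<^sup>2"
        by (simp add: F_def power2_eq_square)
      moreover have "\<bar>Im (E t)\<bar> \<le> T\<^sup>2 / 8" for t
        by (rule order_trans[OF abs_Im_le_cmod norm_E])
      from this[of T] this[of "2 * T"]
      have "\<bar>Im (E T)\<bar> \<le> T\<^sup>2 / 8" "\<bar>Im (E (2 * T))\<bar> \<le> T\<^sup>2 / 8" by blast+
      moreover have "\<bar>Im (\<Sum>n=1..<N. G n t)\<bar> \<le> T\<^sup>2 / 8" if "t \<in> {T..2 * T}" for t
        by (rule order_trans[OF abs_Im_le_cmod norm_G[OF that]])
      from this[of T] this[of "2 * T"]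
      have "\<bar>Im (\<Sum>n=1..<N. G n T)\<bar> \<le> T\<^sup>2 / 8" "\<bar>Im (\<Sum>n=1..<N. G n (2 * T))\<bar> \<le> T\<^sup>2 / 8"
        using T by auto
      ultimately show ?thesis unfolding \<Phi>_def minus_complex.sel plus_complex.sel by linarith
    qed

    define h where "h = (\<lambda>t. (s t - 1) * zeta (s t))"
    have h_eq: "h t = (s t - 1) * zeta_crit t" for t
      by (simp add: h_def s_def zeta_crit_def)
    have "continuous_on {T..2 * T} h"
      unfolding h_eq[abs_def] s_def by (intro continuous_intros continuous_on_zeta_crit)
    hence int_h: "h integrable_on {T..2 * T}" by (rule integrable_continuous_real)
    have diff: "norm (h t - \<Phi>' t) \<le> T / 4" if "t \<in> {T..2 * T}" for t
    proof -
      have "norm (h t - \<Phi>' t) \<le> 2 * (norm (s t))\<^sup>2 / sqrt (real N)"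
        unfolding h_def \<Phi>'_def
        using N0 that T by (intro norm_zeta_partial_sum_diff_le) (auto simp: re im)
      also have "(norm (s t))\<^sup>2 = 1 / 4 + t\<^sup>2"
        unfolding cmod_power2 re im by (simp add: power2_eq_square)
      also have "2 * (1 / 4 + t\<^sup>2) / sqrt (real N) \<le> 2 * (5 * T\<^sup>2) / (40 * T)"
      proof (rule frac_le)
        have "t\<^sup>2 \<le> (2 * T)\<^sup>2" using that T by (intro power_mono) auto
        moreover have "T\<^sup>2 \<ge> 1" using T by (intro one_le_power) auto
        ultimately show "2 * (1 / 4 + t\<^sup>2) \<le> 2 * (5 * T\<^sup>2)" by simp
      qed (use N1 T in auto)
      also have "\<dots> = T / 4" using T by (simp add: power2_eq_square)
      finally show ?thesis .
    qed
    have "norm (integral {T..2 * T} h - (\<Phi> (2 * T) - \<Phi> T)) \<le> T / 4 * measure lborel (cbox T (2 * T))"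
    proof (rule has_integral_bound)
      show "((\<lambda>t. h t - \<Phi>' t) has_integral integral {T..2 * T} h - (\<Phi> (2 * T) - \<Phi> T)) (cbox T (2 * T))"
        using has_integral_diff[OF integrable_integral[OF int_h] int_\<Phi>'] by simp
    qed (use diff T in auto)
    also have "\<dots> = T\<^sup>2 / 4" using T by (simp add: power2_eq_square)
    finally have "Im (integral {T..2 * T} h) \<ge> 3 / 4 * T\<^sup>2"
      using Im_\<Phi> abs_Im_le_cmod[of "integral {T..2 * T} h - (\<Phi> (2 * T) - \<Phi> T)"]
      unfolding minus_complex.sel by linarith
    hence "3 / 4 * T\<^sup>2 \<le> norm (integral {T..2 * T} h)"
      using abs_Im_le_cmod[of "integral {T..2 * T} h"] by linarith
    also have "\<dots> \<le> integral {T..2 * T} (\<lambda>t. 6 * T * (norm (zeta_crit t))\<^sup>2 + 3 * T / 8)"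
    proof (rule integral_norm_bound_integral)
      show "(\<lambda>t. 6 * T * (norm (zeta_crit t))\<^sup>2 + 3 * T / 8) integrable_on {T..2 * T}"
        by (intro integrable_continuous_real continuous_intros continuous_on_zeta_crit)
      fix t assume t: "t \<in> {T..2 * T}"
      define z where "z = norm (zeta_crit t)"
      have "norm (h t) \<le> (3 * T) * z"
        unfolding h_eq norm_mult z_def using norm_s(2)[of t] t T by (intro mult_right_mono) auto
      \<comment> \<open>This linearisation replaces the Cauchy-Schwarz inequality; after integration
        the constant \<open>1 / 8\<close> costs only half of
        \<open>3 / 4 * T\<^sup>2\<close>.\<close>
      also have "z \<le> 2 * z\<^sup>2 + 1 / 8"
        using zero_le_power2[of "z - 1 / 4"] by (simp add: power2_eq_square algebra_simps)
      hence "(3 * T) * z \<le> (3 * T) * (2 * z\<^sup>2 + 1 / 8)" using T by (intro mult_left_mono) auto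
      finally show "norm (h t) \<le> 6 * T * (norm (zeta_crit t))\<^sup>2 + 3 * T / 8"
        by (simp add: z_def algebra_simps)
    qed (rule int_h)
    also have "\<dots> = 6 * T * integral {T..2 * T} (\<lambda>t. (norm (zeta_crit t))\<^sup>2) + 3 * T / 8 * T"
      using T by (subst integral_add)
        (auto intro!: integrable_continuous_real continuous_intros continuous_on_zeta_crit)
    finally have "6 * T * (T / 16) \<le> 6 * T * integral {T..2 * T} (\<lambda>t. (norm (zeta_crit t))\<^sup>2)"
      by (simp add: power2_eq_square)
    thus ?case using T by (subst (asm) mult_le_cancel_left_pos) auto
  qed
qed

section \<open>Growth of the ladder and of the generated points\<close>

lemma eventually_large_pi_mult: "\<forall>\<^sub>F L in sequentially. pi * real L \<ge> c"
  by real_asymp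

context
  fixes \<mu> \<omega> \<phi>1 :: "real \<Rightarrow> real" and y0 T0 :: real
  assumes ladder: "jacobs_ladder y0 \<mu> T0 \<omega> \<phi>1"
begin

lemma ladder_continuous: "continuous_on {T0..} \<phi>1"
  and ladder_differentiable: "t > T0 \<Longrightarrow> \<phi>1 differentiable (at t)"
  and ladder_strict_mono: "strict_mono_on {T0..} \<phi>1"
  and ladder_less: "t \<ge> T0 \<Longrightarrow> \<phi>1 t < t"
  and ladder_at_top: "filterlim \<phi>1 at_top at_top"
  and ladder_deriv: "t > T0 \<Longrightarrow> Z_tilde_sq \<phi>1 t = (norm (zeta_crit t))\<^sup>2 / \<omega> t"
  and ladder_omega: "(\<lambda>t. \<omega> t / ln t - 1) \<in> O[at_top](\<lambda>t. ln (ln t) / ln t)"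
  using ladder unfolding jacobs_ladder_def by blast+

section \<open>Size of \<open>\<omega>\<close> and of the ladder\<close>

lemma omega_over_ln_tendsto: "((\<lambda>t. \<omega> t / ln t) \<longlongrightarrow> 1) at_top"
proof -
  have "((\<lambda>t::real. ln (ln t) / ln t) \<longlongrightarrow> 0) at_top" by real_asymp
  hence "(\<lambda>t::real. ln (ln t) / ln t) \<in> o[at_top](\<lambda>_. 1)"
    by (intro smalloI_tendsto) auto
  hence "(\<lambda>t. \<omega> t / ln t - 1) \<in> o[at_top](\<lambda>_. 1)"
    by (rule landau_o.big_small_trans[OF ladder_omega])
  from smalloD_tendsto[OF this] have "((\<lambda>t. \<omega> t / ln t - 1) \<longlongrightarrow> 0) at_top" by simp
  from tendsto_add[OF this tendsto_const[of 1]] show ?thesis by simp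
qed

lemma eventually_omega_bounds: "\<forall>\<^sub>F t in at_top. 0 < \<omega> t \<and> \<omega> t \<le> 2 * ln t"
proof -
  have "\<forall>\<^sub>F t in at_top. 0 < \<omega> t / ln t" "\<forall>\<^sub>F t in at_top. \<omega> t / ln t < 2"
    using order_tendstoD[OF omega_over_ln_tendsto] by auto
  thus ?thesis using eventually_gt_at_top[of 1]
  proof eventually_elim
    case (elim t)
    hence "ln t > 0" by simp
    with elim show ?case by (simp add: field_simps zero_less_mult_iff)
  qed
qed

text \<open>On \<open>{T..2 * T}\<close> the derivative of \<open>\<phi>1\<close> is at least
  |zeta|^2 divided by \<open>2 * ln (2 * T)\<close>; integrate this and drop
  \<open>\<phi>1 T \<ge> 0\<close>. The loss of a logarithm is harmless, since only
  \<open>ln (\<phi>1 T)\<close> matters later.\<close>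

lemma eventually_ladder_ge: "\<forall>\<^sub>F T in at_top. \<phi>1 T \<ge> T / (64 * ln T)"
proof -
  have "\<forall>\<^sub>F T in at_top. (0 < \<omega> T \<and> \<omega> T \<le> 2 * ln T) \<and> \<phi>1 T \<ge> 0 \<and> T > T0 \<and> T > 1 \<and>
     T / 16 \<le> integral {T..2 * T} (\<lambda>t. (norm (zeta_crit t))\<^sup>2)"
    using ladder_at_top
    by (intro eventually_conj eventually_omega_bounds eventually_integral_zeta_crit_sq_ge eventually_gt_at_top)
       (simp_all add: filterlim_at_top)
  then obtain T1 where "\<And>T. T \<ge> T1 \<Longrightarrow> (0 < \<omega> T \<and> \<omega> T \<le> 2 * ln T) \<and> \<phi>1 T \<ge> 0 \<and> T > T0 \<and> T > 1 \<and>
     T / 16 \<le> integral {T..2 * T} (\<lambda>t. (norm (zeta_crit t))\<^sup>2)"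
    unfolding eventually_at_top_linorder by blast
  hence T1: "0 < \<omega> T" "\<omega> T \<le> 2 * ln T" "\<phi>1 T \<ge> 0" "T > T0" "T > 1"
     "T / 16 \<le> integral {T..2 * T} (\<lambda>t. (norm (zeta_crit t))\<^sup>2)" if "T \<ge> T1" for T
    using that by blast+
  have "\<phi>1 (2 * T) \<ge> (2 * T) / (64 * ln (2 * T))" if "T \<ge> T1" for T
  proof -
    have T: "T > 1" using T1(5)[OF that] .
    hence ln_pos: "ln (2 * T) > 0" by simp
    have deriv_int: "(deriv \<phi>1 has_integral \<phi>1 (2 * T) - \<phi>1 T) {T..2 * T}"
    proof (rule fundamental_theorem_of_calculus)
      fix t assume "t \<in> {T..2 * T}"
      hence "t > T0" using T1(4)[OF that] by simp
      hence "(\<phi>1 has_real_derivative deriv \<phi>1 t) (at t)"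
        using ladder_differentiable by (simp add: DERIV_deriv_iff_real_differentiable)
      thus "(\<phi>1 has_vector_derivative deriv \<phi>1 t) (at t within {T..2 * T})"
        unfolding has_real_derivative_iff_has_vector_derivative
        by (rule has_vector_derivative_at_within)
    qed (use T in auto)
    have zeta_int: "((\<lambda>t. (norm (zeta_crit t))\<^sup>2 / (2 * ln (2 * T))) has_integral
        integral {T..2 * T} (\<lambda>t. (norm (zeta_crit t))\<^sup>2) / (2 * ln (2 * T))) {T..2 * T}"
      by (intro has_integral_divide integrable_integral integrable_continuous_real
            continuous_intros continuous_on_zeta_crit)
    have "(norm (zeta_crit t))\<^sup>2 / (2 * ln (2 * T)) \<le> deriv \<phi>1 t" if t: "t \<in> {T..2 * T}" for t
    proof -
      have "t \<ge> T1" using t \<open>T \<ge> T1\<close> by simp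
      have "ln t \<le> ln (2 * T)" using t T by (subst ln_le_cancel_iff) auto
      hence "\<omega> t \<le> 2 * ln (2 * T)" using T1(2)[OF \<open>t \<ge> T1\<close>] by linarith
      hence "(norm (zeta_crit t))\<^sup>2 / (2 * ln (2 * T)) \<le> (norm (zeta_crit t))\<^sup>2 / \<omega> t"
        using T1(1)[OF \<open>t \<ge> T1\<close>] by (intro divide_left_mono mult_pos_pos) auto
      thus ?thesis using ladder_deriv[OF T1(4)[OF \<open>t \<ge> T1\<close>]] by (simp add: Z_tilde_sq_def)
    qed
    with zeta_int deriv_int have le: "integral {T..2 * T} (\<lambda>t. (norm (zeta_crit t))\<^sup>2) / (2 * ln (2 * T)) \<le> \<phi>1 (2 * T) - \<phi>1 T"
      by (rule has_integral_le)
    have "(T / 16) / (2 * ln (2 * T)) \<le>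
        integral {T..2 * T} (\<lambda>t. (norm (zeta_crit t))\<^sup>2) / (2 * ln (2 * T))"
      using T1(6)[OF that] ln_pos by (intro divide_right_mono) auto
    moreover have "(2 * T) / (64 * ln (2 * T)) = (T / 16) / (2 * ln (2 * T))" by simp
    ultimately show ?thesis using T1(3)[OF that] le by linarith
  qed
  \<comment> \<open>Halving \<open>T\<close> moves the bound from \<open>2 * T\<close> to
    \<open>T\<close>.\<close>
  from this[of "T / 2" for T] have "\<phi>1 T \<ge> T / (64 * ln T)" if "T \<ge> 2 * T1" for T
    using that by simp
  thus ?thesis unfolding eventually_at_top_linorder by blast
qed

text \<open>Above, \<open>\<phi>1 T < T\<close> suffices; below, the loss \<open>64 * ln T\<close>
  disappears after taking logarithms.\<close>

lemma ln_ladder_over_ln_tendsto: "((\<lambda>T. ln (\<phi>1 T) / ln T) \<longlongrightarrow> 1) at_top"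
proof (rule tendsto_sandwich)
  show "\<forall>\<^sub>F T in at_top. ln (T / (64 * ln T)) / ln T \<le> ln (\<phi>1 T) / ln T"
    using eventually_ladder_ge eventually_gt_at_top[of 1]
  proof eventually_elim
    case (elim T)
    hence pos: "0 < T / (64 * ln T)" by simp
    with elim(1) have "ln (T / (64 * ln T)) \<le> ln (\<phi>1 T)" by (subst ln_le_cancel_iff) linarith+
    thus ?case using elim by (intro divide_right_mono) auto
  qed
  show "\<forall>\<^sub>F T in at_top. ln (\<phi>1 T) / ln T \<le> 1"
    using eventually_gt_at_top[of 1] eventually_ge_at_top[of T0]
      ladder_at_top[unfolded filterlim_at_top_dense, rule_format, of 0]
  proof eventually_elim
    case (elim T)
    hence "ln (\<phi>1 T) \<le> ln T" using ladder_less[of T] by (subst ln_le_cancel_iff) auto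
    thus ?case using elim by (simp add: divide_le_eq)
  qed
  show "((\<lambda>T::real. ln (T / (64 * ln T)) / ln T) \<longlongrightarrow> 1) at_top" by real_asymp
qed auto

section \<open>Reverse iterates and the location of generated points\<close>

lemma ladder_surj:
  assumes "y \<ge> \<phi>1 T0"
  shows "y \<in> \<phi>1 ` {T0..}"
proof -
  have "\<forall>\<^sub>F t in at_top. y \<le> \<phi>1 t" using ladder_at_top by (simp add: filterlim_at_top)
  with eventually_ge_at_top[of T0] have "\<forall>\<^sub>F t in at_top. T0 \<le> t \<and> y \<le> \<phi>1 t"
    by eventually_elim auto
  then obtain t where t: "T0 \<le> t" "y \<le> \<phi>1 t"
    using eventually_happens'[OF trivial_limit_at_top_linorder] by blast
  have "continuous_on {T0..t} \<phi>1"
    by (rule continuous_on_subset[OF ladder_continuous]) auto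
  from IVT'[OF assms t(2) t(1) this] show ?thesis by force
qed

text \<open>\<open>the_inv_into\<close> is meaningful only on the range of \<open>\<phi>1\<close>.
  Since \<open>\<phi>1 t < t\<close>, preimages move to the right, so all iterates stay above
  \<open>x\<close>, hence above \<open>\<phi>1 T0\<close>, and remain in that range.\<close>

lemma rev_iter_properties:
  assumes "x \<ge> T0" "x \<ge> \<phi>1 T0"
  shows "rev_iter \<phi>1 T0 r x \<ge> x" (is ?A)
    and "\<phi>1 (rev_iter \<phi>1 T0 (Suc r) x) = rev_iter \<phi>1 T0 r x" (is ?B)
proof -
  have inj: "inj_on \<phi>1 {T0..}"
    by (rule strict_mono_on_imp_inj_on[OF ladder_strict_mono])
  have step: "\<phi>1 (rev_iter \<phi>1 T0 (Suc r) x) = rev_iter \<phi>1 T0 r x \<and> rev_iter \<phi>1 T0 (Suc r) x \<ge> T0"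
    if "rev_iter \<phi>1 T0 r x \<ge> x" for r
  proof -
    have "rev_iter \<phi>1 T0 r x \<in> \<phi>1 ` {T0..}"
      using that assms by (intro ladder_surj) linarith
    thus ?thesis
      using f_the_inv_into_f[OF inj] the_inv_into_into[OF inj _ order_refl] by auto
  qed
  show ?A
  proof (induction r)
    case (Suc r)
    thus ?case using step[OF Suc] ladder_less by fastforce
  qed auto
  thus ?B using step by blast
qed

text \<open>Descending induction from \<open>r = k\<close>, where the bounds are part of the
  definition; the increasing function \<open>\<phi>1\<close> carries them from \<open>Suc r\<close>
  to \<open>r\<close>.\<close>

lemma generated_by_between:
  assumes "generated_by \<phi>1 T0 f U L k \<alpha>" "pi * real L \<ge> T0" "pi * real L \<ge> \<phi>1 T0" "U > 0" "r \<le> k"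
  shows "rev_iter \<phi>1 T0 r (pi * real L) < \<alpha> r \<and> \<alpha> r < rev_iter \<phi>1 T0 r (pi * real L + U)"
  using \<open>r \<le> k\<close>
proof (induction rule: inc_induct)
  case base
  show ?case using assms(1) by (simp add: generated_by_def Let_def)
next
  case (step r)
  let ?a = "rev_iter \<phi>1 T0 (Suc r) (pi * real L)" and ?b = "rev_iter \<phi>1 T0 (Suc r) (pi * real L + U)"
  have "\<alpha> r = \<phi>1 (\<alpha> (Suc r))"
    using assms(1) step.hyps by (force simp: generated_by_def Let_def)
  moreover have a: "?a \<ge> T0" "\<phi>1 ?a = rev_iter \<phi>1 T0 r (pi * real L)"
    using rev_iter_properties[of "pi * real L"] assms order_trans by blast+
  moreover have b: "\<phi>1 ?b = rev_iter \<phi>1 T0 r (pi * real L + U)"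
    using rev_iter_properties[of "pi * real L + U"] assms by auto
  moreover have "\<phi>1 ?a < \<phi>1 (\<alpha> (Suc r))" "\<phi>1 (\<alpha> (Suc r)) < \<phi>1 ?b"
    using strict_mono_onD[OF ladder_strict_mono] step.IH a(1) by auto
  ultimately show ?case by simp
qed

section \<open>Asymptotics of generated points as L tends to infinity\<close>

context
  fixes f :: "nat \<Rightarrow> real \<Rightarrow> real" and U :: real and k :: nat and \<alpha> :: "nat \<Rightarrow> nat \<Rightarrow> real"
  assumes U: "U > 0"
    and gen: "\<forall>\<^sub>F L in sequentially. generated_by \<phi>1 T0 (f L) U L k (\<alpha> L)"
begin

lemma eventually_generated_bounds:
  "\<forall>\<^sub>F L in sequentially. \<alpha> L 0 < pi * real L + U \<and>
     (\<forall>r\<le>k. pi * real L < \<alpha> L r) \<and> (\<forall>r<k. \<alpha> L r = \<phi>1 (\<alpha> L (Suc r)))"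
  using gen eventually_large_pi_mult[of T0] eventually_large_pi_mult[of "\<phi>1 T0"]
proof eventually_elim
  case (elim L)
  have "\<alpha> L r = \<phi>1 (\<alpha> L (Suc r))" if "r < k" for r
    using elim(1) that by (force simp: generated_by_def Let_def)
  moreover have "pi * real L < \<alpha> L r" if "r \<le> k" for r
    using generated_by_between[OF elim U that] rev_iter_properties(1)[OF elim(2,3), of r] by linarith
  ultimately show ?case using generated_by_between[OF elim U, of 0] by auto
qed

lemma generated_at_top:
  assumes "r \<le> k"
  shows "filterlim (\<lambda>L. \<alpha> L r) at_top sequentially"
proof (rule filterlim_at_top_mono)
  show "filterlim (\<lambda>L. pi * real L) at_top sequentially" by real_asymp
  show "\<forall>\<^sub>F L in sequentially. pi * real L \<le> \<alpha> L r"
    using eventually_generated_bounds by eventually_elim (use assms in auto)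
qed

text \<open>\<open>\<alpha> L 0\<close> is trapped between \<open>pi * real L\<close> and
  \<open>pi * real L + U\<close>, and each relation
  \<open>\<alpha> L r = \<phi>1 (\<alpha> L (Suc r))\<close> preserves the logarithm
  asymptotically.\<close>

lemma ln_generated_tendsto:
  assumes "r \<le> k"
  shows "(\<lambda>L. ln (\<alpha> L r) / ln (pi * real L)) \<longlonglongrightarrow> 1"
  using assms
proof (induction r)
  case 0
  show ?case
  proof (rule tendsto_sandwich)
    show "\<forall>\<^sub>F L in sequentially. 1 \<le> ln (\<alpha> L 0) / ln (pi * real L)"
      using eventually_generated_bounds eventually_large_pi_mult[of 2]
    proof eventually_elim
      case (elim L)
      hence "pi * real L < \<alpha> L 0" by auto
      hence "ln (pi * real L) \<le> ln (\<alpha> L 0)" using elim(2) by (subst ln_le_cancel_iff) linarith+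
      moreover have "ln (pi * real L) > 0" using elim(2) by (intro ln_gt_zero) linarith
      ultimately show ?case by simp
    qed
    show "\<forall>\<^sub>F L in sequentially. ln (\<alpha> L 0) / ln (pi * real L) \<le> ln (pi * real L + U) / ln (pi * real L)"
      using eventually_generated_bounds eventually_large_pi_mult[of 2]
    proof eventually_elim
      case (elim L)
      hence "pi * real L < \<alpha> L 0" "\<alpha> L 0 < pi * real L + U" by auto
      hence "ln (\<alpha> L 0) \<le> ln (pi * real L + U)" using elim(2) by (subst ln_le_cancel_iff) linarith+
      moreover have "ln (pi * real L) > 0" using elim(2) by (intro ln_gt_zero) linarith
      ultimately show ?case by (intro divide_right_mono) auto
    qed
    show "(\<lambda>L. ln (pi * real L + U) / ln (pi * real L)) \<longlonglongrightarrow> 1" using U by real_asymp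
  qed auto
next
  case (Suc r)
  have lim: "filterlim (\<lambda>L. \<alpha> L (Suc r)) at_top sequentially" by (rule generated_at_top[OF Suc.prems])
  have "(\<lambda>L. ln (\<phi>1 (\<alpha> L (Suc r))) / ln (\<alpha> L (Suc r))) \<longlonglongrightarrow> 1"
    by (rule filterlim_compose[OF ln_ladder_over_ln_tendsto lim])
  moreover have "(\<lambda>L. ln (\<alpha> L r) / ln (pi * real L)) \<longlonglongrightarrow> 1" using Suc by simp
  ultimately have "(\<lambda>L. (ln (\<alpha> L r) / ln (pi * real L)) / (ln (\<phi>1 (\<alpha> L (Suc r))) / ln (\<alpha> L (Suc r)))) \<longlonglongrightarrow> 1 / 1"
    by (intro tendsto_divide) auto
  \<comment> \<open>\<open>ln (\<alpha> L r)\<close> cancels; it is nonzero because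
    \<open>\<alpha> L r\<close> exceeds 2.\<close>
  moreover have "\<forall>\<^sub>F L in sequentially. (ln (\<alpha> L r) / ln (pi * real L)) / (ln (\<phi>1 (\<alpha> L (Suc r))) / ln (\<alpha> L (Suc r)))
      = ln (\<alpha> L (Suc r)) / ln (pi * real L)"
    using eventually_generated_bounds eventually_large_pi_mult[of 2]
  proof eventually_elim
    case (elim L)
    have "\<alpha> L r = \<phi>1 (\<alpha> L (Suc r))" using elim(1) Suc.prems by simp
    moreover have "\<alpha> L r > pi * real L"
      using elim(1) Suc_leD[OF Suc.prems] by blast
    with elim(2) have "ln (\<alpha> L r) > 0" by (intro ln_gt_zero) linarith
    ultimately show ?case by (simp add: field_simps)
  qed
  ultimately show ?case by (simp add: tendsto_cong)
qed

text \<open>The normalisation \<open>ln (pi * real L)\<close> is common to all generating functions,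
  so its \<open>k\<close>-th power can join the factor \<open>\<kappa>\<close> of the next
  lemma.\<close>

lemma prod_omega_tendsto:
  "(\<lambda>L. \<Prod>r=1..k. \<omega> (\<alpha> L r) / ln (pi * real L)) \<longlonglongrightarrow> 1"
proof -
  have "(\<lambda>L. \<omega> (\<alpha> L r) / ln (pi * real L)) \<longlonglongrightarrow> 1" if r: "r \<in> {1..k}" for r
  proof -
    have lim: "filterlim (\<lambda>L. \<alpha> L r) at_top sequentially" using r by (intro generated_at_top) auto
    have "(\<lambda>L. (\<omega> (\<alpha> L r) / ln (\<alpha> L r)) * (ln (\<alpha> L r) / ln (pi * real L))) \<longlonglongrightarrow> 1 * 1"
      using r by (intro tendsto_mult filterlim_compose[OF omega_over_ln_tendsto lim] ln_generated_tendsto) auto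
    moreover have "\<forall>\<^sub>F L in sequentially. (\<omega> (\<alpha> L r) / ln (\<alpha> L r)) * (ln (\<alpha> L r) / ln (pi * real L))
        = \<omega> (\<alpha> L r) / ln (pi * real L)"
      using lim[unfolded filterlim_at_top_dense, rule_format, of 1]
      by eventually_elim auto
    ultimately show ?thesis by (subst (asm) tendsto_cong) simp_all
  qed
  from tendsto_prod[of "{1..k}" "\<lambda>r L. \<omega> (\<alpha> L r) / ln (pi * real L)" "\<lambda>_. 1", OF this]
  show ?thesis by simp
qed

text \<open>The generating relation with \<open>Z_tilde_sq\<close> replaced by |zeta|^2 over
  \<open>\<omega>\<close>. Here \<open>\<kappa>\<close> depends neither on \<open>f\<close> nor on
  the points, which is why it cancels between different generating functions.\<close>

lemma eventually_generated_eq: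
  defines "\<kappa> \<equiv> \<lambda>L. ln (pi * real L) ^ k /
      (rev_iter \<phi>1 T0 k (pi * real L + U) - rev_iter \<phi>1 T0 k (pi * real L))"
  shows "\<forall>\<^sub>F L in sequentially. \<kappa> L > 0 \<and> (\<Prod>r=1..k. \<omega> (\<alpha> L r) / ln (pi * real L)) > 0 \<and>
     pi * real L < \<alpha> L 0 \<and>
     f L (\<alpha> L 0) * (\<Prod>r=1..k. norm (zeta_crit (\<alpha> L r)))\<^sup>2 =
       integral {pi * real L..pi * real L + U} (f L) *
         (\<Prod>r=1..k. \<omega> (\<alpha> L r) / ln (pi * real L)) * \<kappa> L"
  using gen eventually_generated_bounds order_tendstoD(1)[OF prod_omega_tendsto zero_less_one]
    eventually_large_pi_mult[of "max 2 (T0 + 1)"]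
proof eventually_elim
  case (elim L)
  define d where "d = rev_iter \<phi>1 T0 k (pi * real L + U) - rev_iter \<phi>1 T0 k (pi * real L)"
  define l where "l = ln (pi * real L)"
  define W where "W = (\<Prod>r=1..k. \<omega> (\<alpha> L r))"
  define P where "P = (\<Prod>r=1..k. norm (zeta_crit (\<alpha> L r)))"
  have l: "l > 0" unfolding l_def using elim(4) by (intro ln_gt_zero) linarith
  \<comment> \<open>The open interval containing \<open>\<alpha> L k\<close> is nonempty.\<close>
  have d: "d > 0" using elim(1) by (auto simp: generated_by_def Let_def d_def)
  have q: "(\<Prod>r=1..k. \<omega> (\<alpha> L r) / ln (pi * real L)) = W / l ^ k"
    by (simp add: prod_dividef W_def l_def)
  have W: "W \<noteq> 0" using elim(3) unfolding q by auto
  have "integral {pi * real L..pi * real L + U} (f L) = f L (\<alpha> L 0) * (\<Prod>r=1..k. Z_tilde_sq \<phi>1 (\<alpha> L r)) * d"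
    using elim(1) by (simp add: generated_by_def Let_def d_def)
  also have "(\<Prod>r=1..k. Z_tilde_sq \<phi>1 (\<alpha> L r)) = (\<Prod>r=1..k. (norm (zeta_crit (\<alpha> L r)))\<^sup>2 / \<omega> (\<alpha> L r))"
  proof (intro prod.cong refl ladder_deriv)
    fix r assume "r \<in> {1..k}"
    hence "pi * real L < \<alpha> L r" using elim(2) by auto
    thus "T0 < \<alpha> L r" using elim(4) by linarith
  qed
  also have "\<dots> = P\<^sup>2 / W" by (simp add: prod_dividef prod_power_distrib P_def W_def)
  finally have "f L (\<alpha> L 0) * P\<^sup>2 =
      integral {pi * real L..pi * real L + U} (f L) * (W / l ^ k) * (l ^ k / d)"
    using W d l by (simp add: field_simps)
  thus ?case using elim(2,3) d l unfolding q \<kappa>_def P_def l_def d_def by simp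
qed

end

end

section \<open>Evaluation of the limit\<close>

lemma integral_powr_from_base:
  fixes a U p :: real
  assumes "p > -1" "U \<ge> 0"
  shows "integral {a..a + U} (\<lambda>t. (t - a) powr p) = U powr (p + 1) / (p + 1)"
proof -
  have "((\<lambda>x. x powr p) has_integral U powr (p + 1) / (p + 1)) {0..U}"
    using assms by (intro has_integral_powr_from_0) auto
  hence "((\<lambda>t. (t - a) powr p) has_integral U powr (p + 1) / (p + 1)) {a..a + U}"
    using has_integral_shift_Icc_real[of "\<lambda>t. (t - a) powr p" a _ 0 U] by (simp add: o_def add_ac)
  thus ?thesis by (rule integral_unique)
qed

text \<open>One antiderivative with a sign \<open>c\<close> serves both integrals. The shift by
  \<open>pi * real L\<close> changes \<open>sin\<close> and \<open>cos\<close> by the same sign, so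
  their product is unaffected.\<close>

lemma integral_sin_sq_cos_sq_pi_mult:
  fixes U :: real
  assumes "U \<ge> 0"
  shows "integral {pi * real L..pi * real L + U} (\<lambda>t. (sin t)\<^sup>2) = (U - sin U * cos U) / 2"
    and "integral {pi * real L..pi * real L + U} (\<lambda>t. (cos t)\<^sup>2) = (U + sin U * cos U) / 2"
proof -
  define F where "F = (\<lambda>c t :: real. (t + c * (sin t * cos t)) / 2)"
  have F: "F c (pi * real L + U) - F c (pi * real L) = (U + c * (sin U * cos U)) / 2" for c
  proof -
    have "cos (pi * real L) * cos (pi * real L) = 1"
      using cos_npi2[of L] by (simp add: power_mult_distrib[symmetric] flip: power_add mult_2)
    hence "sin (pi * real L + U) * cos (pi * real L + U) = sin U * cos U"
      by (simp add: sin_add cos_add mult_ac)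
    thus ?thesis by (simp add: F_def field_simps)
  qed
  have "((\<lambda>t. (1 + c * ((cos t)\<^sup>2 - (sin t)\<^sup>2)) / 2) has_integral (U + c * (sin U * cos U)) / 2)
      {pi * real L..pi * real L + U}" for c
    unfolding F[symmetric]
  proof (rule fundamental_theorem_of_calculus)
    fix t
    have "(F c has_real_derivative (1 + c * ((cos t)\<^sup>2 - (sin t)\<^sup>2)) / 2) (at t)"
      unfolding F_def by (auto intro!: derivative_eq_intros simp: power2_eq_square)
    thus "(F c has_vector_derivative (1 + c * ((cos t)\<^sup>2 - (sin t)\<^sup>2)) / 2)
        (at t within {pi * real L..pi * real L + U})"
      unfolding has_real_derivative_iff_has_vector_derivative by (rule has_vector_derivative_at_within)
  qed (use assms in auto)
  note int = this
  have sin: "(1 + - 1 * ((cos t)\<^sup>2 - (sin t)\<^sup>2)) / 2 = (sin t)\<^sup>2" for t :: real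
    by (simp add: cos_squared_eq)
  show "integral {pi * real L..pi * real L + U} (\<lambda>t. (sin t)\<^sup>2) = (U - sin U * cos U) / 2"
    using int[of "- 1"] unfolding sin by (simp add: integral_unique)
  have cos: "(1 + 1 * ((cos t)\<^sup>2 - (sin t)\<^sup>2)) / 2 = (cos t)\<^sup>2" for t :: real
    by (simp add: sin_squared_eq)
  show "integral {pi * real L..pi * real L + U} (\<lambda>t. (cos t)\<^sup>2) = (U + sin U * cos U) / 2"
    using int[of 1] unfolding cos by (simp add: integral_unique)
qed

section \<open>Combination of the generating relations\<close>

text \<open>The powers 3/2 and 5/2 turn the exponents 1/3 and 1/5 both into 1/2, and
  \<open>\<kappa>\<close> cancels because 1 + 3/2 = 5/2.\<close>

lemma cancel_common_factor:
  fixes x y p q v w :: real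
  assumes "x > 0" "y > 0" "q \<ge> 0" "w \<ge> 0" "\<kappa> > 0" "A > 0" "B > 0"
    and q: "x powr (1/3) * q\<^sup>2 = A * \<kappa>" and w: "y powr (1/5) * w\<^sup>2 = B * \<kappa>"
    and p: "v * p\<^sup>2 = C * \<kappa>"
  shows "(x / y) powr (1/2) * (p\<^sup>2 * q ^ 3 / w ^ 5) * v = C * (A powr (3/2) / B powr (5/2))"
proof -
  \<comment> \<open>Zero is excluded by the positive right-hand sides \<open>A * \<kappa>\<close>
    and \<open>B * \<kappa>\<close>.\<close>
  have "q \<noteq> 0" "w \<noteq> 0" using q w assms(5-7) by auto
  hence pos: "q > 0" "w > 0" using assms by auto
  have "(x powr (1/3) * q\<^sup>2) powr (3/2) = x powr (1/2) * q ^ 3"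
    using assms(1) pos by (simp add: powr_mult powr_powr flip: powr_numeral)
  hence 1: "x powr (1/2) * q ^ 3 = A powr (3/2) * \<kappa> powr (3/2)"
    unfolding q using assms(5-7) by (simp add: powr_mult)
  have "(y powr (1/5) * w\<^sup>2) powr (5/2) = y powr (1/2) * w ^ 5"
    using assms(2) pos by (simp add: powr_mult powr_powr flip: powr_numeral)
  hence 2: "y powr (1/2) * w ^ 5 = B powr (5/2) * \<kappa> powr (5/2)"
    unfolding w using assms(5-7) by (simp add: powr_mult)
  have 3: "\<kappa> powr (5/2) = \<kappa> powr (3/2) * \<kappa>"
    using assms powr_add[of \<kappa> "3/2" 1] by simp
  have "(x / y) powr (1/2) * (p\<^sup>2 * q ^ 3 / w ^ 5) * v =
      (v * p\<^sup>2) * (x powr (1/2) * q ^ 3) / (y powr (1/2) * w ^ 5)"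
    using assms(1,2) by (simp add: powr_divide)
  also have "\<dots> = C * (A powr (3/2) / B powr (5/2))"
    unfolding 1 2 3 p using assms(5-7) by simp
  finally show ?thesis .
qed

text \<open>The bases come from integrating the powers 1/3 and 1/5; the value is 27/25 times the
  square root of 9/10.\<close>

lemma powr_constant: "(3/4 :: real) powr (3/2) / (5/6) powr (5/2) = 81 / 250 * sqrt 10"
proof -
  have "(3/4 :: real) powr (3/2) = 3/4 * sqrt (3/4)"
    using powr_add[of "3/4 :: real" 1 "1/2"] by (simp add: powr_half_sqrt)
  moreover have "(5/6 :: real) powr (5/2) = (5/6)\<^sup>2 * sqrt (5/6)"
    using powr_add[of "5/6 :: real" 2 "1/2"] by (simp add: powr_half_sqrt)
  moreover have "sqrt (3/4) / sqrt (5/6) = 3 / 10 * sqrt 10"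
  proof -
    have "sqrt (3/4) / sqrt (5/6) = sqrt ((3/10)\<^sup>2 * 10)"
      by (simp add: real_sqrt_divide[symmetric] power2_eq_square)
    thus ?thesis by (simp add: real_sqrt_mult)
  qed
  ultimately have "(3/4 :: real) powr (3/2) / (5/6) powr (5/2) = (3/4) / (5/6)\<^sup>2 * (3 / 10 * sqrt 10)"
    by (metis times_divide_times_eq)
  thus ?thesis by (simp add: power2_eq_square)
qed

text \<open>After the common factor cancels, only the normalised products of \<open>\<omega>\<close>
  remain, and they tend to 1. A general \<open>f\<close> covers both the sine and the cosine
  summand.\<close>

lemma product_term_tendsto:
  fixes \<beta> \<gamma> \<delta> :: "nat \<Rightarrow> nat \<Rightarrow> real"
  assumes ladder: "jacobs_ladder y0 \<mu> T0 \<omega> \<phi>1" and U: "U > 0"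
    and \<beta>: "\<forall>\<^sub>F L in sequentially. generated_by \<phi>1 T0 (f L) U L k (\<beta> L)"
    and \<gamma>: "\<forall>\<^sub>F L in sequentially. generated_by \<phi>1 T0 (\<lambda>t. (t - pi * real L) powr (1/3)) U L k (\<gamma> L)"
    and \<delta>: "\<forall>\<^sub>F L in sequentially. generated_by \<phi>1 T0 (\<lambda>t. (t - pi * real L) powr (1/5)) U L k (\<delta> L)"
    and J: "\<And>L. integral {pi * real L..pi * real L + U} (f L) = J"
  shows "(\<lambda>L. ((\<gamma> L 0 - pi * real L) / (\<delta> L 0 - pi * real L)) powr (1/2) *
      (\<Prod>r=1..k. (norm (zeta_crit (\<beta> L r)))^2 * (norm (zeta_crit (\<gamma> L r)))^3
                    / (norm (zeta_crit (\<delta> L r)))^5) * f L (\<beta> L 0))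
    \<longlonglongrightarrow> 81 / 250 * sqrt 10 * (J / U)"
proof -
  define q where "q = (\<lambda>(\<alpha> :: nat \<Rightarrow> nat \<Rightarrow> real) L. \<Prod>r=1..k. \<omega> (\<alpha> L r) / ln (pi * real L))"
  define A where "A = 3/4 * U powr (4/3)"
  define B where "B = 5/6 * U powr (6/5)"
  have int3: "integral {pi * real L..pi * real L + U} (\<lambda>t. (t - pi * real L) powr (1/3)) = A" for L
    using U by (subst integral_powr_from_base) (auto simp: A_def)
  have int5: "integral {pi * real L..pi * real L + U} (\<lambda>t. (t - pi * real L) powr (1/5)) = B" for L
    using U by (subst integral_powr_from_base) (auto simp: B_def)
  have AB: "A > 0" "B > 0" using U by (auto simp: A_def B_def)
  have q: "q \<beta> \<longlonglongrightarrow> 1" "q \<gamma> \<longlonglongrightarrow> 1" "q \<delta> \<longlonglongrightarrow> 1"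
    unfolding q_def
    using prod_omega_tendsto[OF ladder U \<beta>] prod_omega_tendsto[OF ladder U \<gamma>]
      prod_omega_tendsto[OF ladder U \<delta>] by simp_all
  have "(\<lambda>L. J * q \<beta> L * ((A * q \<gamma> L) powr (3/2) / (B * q \<delta> L) powr (5/2)))
     \<longlonglongrightarrow> J * 1 * ((A * 1) powr (3/2) / (B * 1) powr (5/2))"
    using AB by (intro tendsto_intros q) auto
  moreover have "\<forall>\<^sub>F L in sequentially. J * q \<beta> L * ((A * q \<gamma> L) powr (3/2) / (B * q \<delta> L) powr (5/2)) =
      ((\<gamma> L 0 - pi * real L) / (\<delta> L 0 - pi * real L)) powr (1/2) *
      (\<Prod>r=1..k. (norm (zeta_crit (\<beta> L r)))^2 * (norm (zeta_crit (\<gamma> L r)))^3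
                    / (norm (zeta_crit (\<delta> L r)))^5) * f L (\<beta> L 0)"
    using eventually_generated_eq[OF ladder U \<beta>] eventually_generated_eq[OF ladder U \<gamma>]
      eventually_generated_eq[OF ladder U \<delta>]
  proof eventually_elim
    case (elim L)
    define \<kappa> where "\<kappa> = ln (pi * real L) ^ k /
      (rev_iter \<phi>1 T0 k (pi * real L + U) - rev_iter \<phi>1 T0 k (pi * real L))"
    define P where "P = (\<lambda>(\<alpha> :: nat \<Rightarrow> nat \<Rightarrow> real). \<Prod>r=1..k. norm (zeta_crit (\<alpha> L r)))"
    have pos: "\<kappa> > 0" "q \<gamma> L > 0" "q \<delta> L > 0" "\<gamma> L 0 - pi * real L > 0" "\<delta> L 0 - pi * real L > 0"
      using elim unfolding \<kappa>_def q_def diff_gt_0_iff_gt by blast+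
    have P_nonneg: "P \<alpha> \<ge> 0" for \<alpha> unfolding P_def by (intro prod_nonneg) auto
    have eqs: "f L (\<beta> L 0) * (P \<beta>)\<^sup>2 = J * q \<beta> L * \<kappa>"
      "(\<gamma> L 0 - pi * real L) powr (1/3) * (P \<gamma>)\<^sup>2 = A * q \<gamma> L * \<kappa>"
      "(\<delta> L 0 - pi * real L) powr (1/5) * (P \<delta>)\<^sup>2 = B * q \<delta> L * \<kappa>"
      using elim unfolding \<kappa>_def q_def P_def int3 int5 J by blast+
    have "(\<Prod>r=1..k. (norm (zeta_crit (\<beta> L r)))^2 * (norm (zeta_crit (\<gamma> L r)))^3
                    / (norm (zeta_crit (\<delta> L r)))^5) =
       (P \<beta>)\<^sup>2 * P \<gamma> ^ 3 / P \<delta> ^ 5"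
      by (simp add: P_def prod_dividef prod.distrib prod_power_distrib)
    moreover have "((\<gamma> L 0 - pi * real L) / (\<delta> L 0 - pi * real L)) powr (1/2) *
        ((P \<beta>)\<^sup>2 * P \<gamma> ^ 3 / P \<delta> ^ 5) * f L (\<beta> L 0) =
        J * q \<beta> L * ((A * q \<gamma> L) powr (3/2) / (B * q \<delta> L) powr (5/2))"
      by (rule cancel_common_factor[OF pos(4,5) P_nonneg P_nonneg pos(1) _ _ eqs(2,3,1)])
         (use pos AB in auto)
    ultimately show ?case by (simp only:)
  qed
  moreover have "J * 1 * ((A * 1) powr (3/2) / (B * 1) powr (5/2)) = 81 / 250 * sqrt 10 * (J / U)"
  proof -
    \<comment> \<open>The powers of \<open>U\<close> are 4/3 times 3/2 and 6/5 times 5/2, that is 2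
      and 3, which leaves \<open>1 / U\<close>.\<close>
    have "A powr (3/2) = (3/4) powr (3/2) * (U powr (4/3)) powr (3/2)"
      "B powr (5/2) = (5/6) powr (5/2) * (U powr (6/5)) powr (5/2)"
      unfolding A_def B_def by (rule powr_mult; simp)+
    moreover have "(U powr (4/3)) powr (3/2) = U powr 2" "(U powr (6/5)) powr (5/2) = U powr 3"
      unfolding powr_powr by simp_all
    ultimately have "(A * 1) powr (3/2) / (B * 1) powr (5/2) = ((3/4) powr (3/2) / (5/6) powr (5/2)) * (U powr 2 / U powr 3)"
      by (simp only: mult_1_right times_divide_times_eq)
    also have "U powr 2 / U powr 3 = 1 / U" using U by (simp add: field_simps power_numeral_reduce)
    finally show ?thesis unfolding powr_constant by simp
  qed
  ultimately show ?thesis by (simp add: tendsto_cong)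
qed

theorem mainTheorem3:
  fixes \<mu> \<omega> \<phi>1 :: "real \<Rightarrow> real" and y0 T0 U :: real and k0 k1 k2 :: nat
    and \<alpha> :: "nat \<Rightarrow> nat \<Rightarrow> nat \<Rightarrow> nat \<Rightarrow> real"
      \<comment> \<open>\<open>\<alpha> i k L r\<close> is the point with upper indices \<open>i, k\<close> and lower index \<open>r\<close>, for the given \<open>L\<close>\<close>
  assumes mu: "admissible_mu y0 \<mu>"
    and ladder: "jacobs_ladder y0 \<mu> T0 \<omega> \<phi>1"
    and k1: "1 \<le> k1" "k1 \<le> k0"
    and k2: "1 \<le> k2" "k2 \<le> k0"
    and U: "0 < U" "U < pi / 2"
    and gen1: "\<forall>\<^sub>F L in sequentially. generated_by \<phi>1 T0 (f_gen 1 L) U L k1 (\<alpha> 1 k1 L)"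
    and gen2: "\<forall>\<^sub>F L in sequentially. generated_by \<phi>1 T0 (f_gen 2 L) U L k2 (\<alpha> 2 k2 L)"
    and gen34: "\<And>i k. i \<in> {3, 4} \<Longrightarrow> k \<in> {k1, k2} \<Longrightarrow>
       \<forall>\<^sub>F L in sequentially. generated_by \<phi>1 T0 (f_gen i L) U L k (\<alpha> i k L)"
  shows "(\<lambda>L.
      ((\<alpha> 3 k2 L 0 - pi * real L) / (\<alpha> 4 k2 L 0 - pi * real L)) powr (1/2) *
      (\<Prod>r=1..k2. (cmod (zeta_crit (\<alpha> 2 k2 L r)))^2 * (cmod (zeta_crit (\<alpha> 3 k2 L r)))^3
                    / (cmod (zeta_crit (\<alpha> 4 k2 L r)))^5) *
      (cos (\<alpha> 2 k2 L 0))^2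
    + ((\<alpha> 3 k1 L 0 - pi * real L) / (\<alpha> 4 k1 L 0 - pi * real L)) powr (1/2) *
      (\<Prod>r=1..k1. (cmod (zeta_crit (\<alpha> 1 k1 L r)))^2 * (cmod (zeta_crit (\<alpha> 3 k1 L r)))^3
                    / (cmod (zeta_crit (\<alpha> 4 k1 L r)))^5) *
      (sin (\<alpha> 1 k1 L 0))^2)
    \<sim>[sequentially] (\<lambda>_. 81 / 250 * sqrt 10)"
proof -
  have f_eqs: "f_gen 1 L = (\<lambda>t. (sin t)\<^sup>2)" "f_gen 2 L = (\<lambda>t. (cos t)\<^sup>2)"
    "f_gen 3 L = (\<lambda>t. (t - pi * real L) powr (1/3))"
    "f_gen 4 L = (\<lambda>t. (t - pi * real L) powr (1/5))" for L
    by (simp_all add: f_gen_def fun_eq_iff)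
  have gen3: "\<forall>\<^sub>F L in sequentially.
      generated_by \<phi>1 T0 (\<lambda>t. (t - pi * real L) powr (1/3)) U L k (\<alpha> 3 k L)" if "k \<in> {k1, k2}" for k
    using gen34[of 3 k] that by (simp add: f_eqs)
  have gen4: "\<forall>\<^sub>F L in sequentially.
      generated_by \<phi>1 T0 (\<lambda>t. (t - pi * real L) powr (1/5)) U L k (\<alpha> 4 k L)" if "k \<in> {k1, k2}" for k
    using gen34[of 4 k] that by (simp add: f_eqs)
  note t2 = product_term_tendsto[OF ladder U(1) gen2[unfolded f_eqs] gen3[of k2] gen4[of k2]
      integral_sin_sq_cos_sq_pi_mult(2)[OF less_imp_le[OF U(1)]], OF insertI2[OF singletonI] insertI2[OF singletonI]]
  note t1 = product_term_tendsto[OF ladder U(1) gen1[unfolded f_eqs] gen3[of k1] gen4[of k1]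
      integral_sin_sq_cos_sq_pi_mult(1)[OF less_imp_le[OF U(1)]], OF insertI1 insertI1]
  \<comment> \<open>The terms \<open>sin U * cos U\<close> cancel: this is the integrated form of
    the Pythagorean identity.\<close>
  have sum: "81 / 250 * sqrt 10 * ((U + sin U * cos U) / 2 / U) +
      81 / 250 * sqrt 10 * ((U - sin U * cos U) / 2 / U) = 81 / 250 * sqrt 10"
    using U by (simp add: field_simps)
  show ?thesis
    \<comment> \<open>The closing \<open>simp\<close> checks that the limit is nonzero, as needed to
      pass from convergence to asymptotic equivalence.\<close>
    by (rule tendsto_imp_asymp_equiv_const[OF tendsto_add[OF t2 t1, unfolded sum]]) simp
qed

end
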